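(* Let $\Omega\subset\mathbb{O}$ be a domain. Every slice Fueter-regular function $f:\Omega\to\mathbb{O}$ is real analytic with respect to the real variables $x_0,\dots,x_7$.
   Context: Octonions. $\mathbb{O}$ is the real (non-associative) division algebra with basis $e_0=1,e_1,\dots,e_7$, with $e_l e_l=-1$ for $l\ge 1$ and $e_le_m=\sum_n\epsilon_{lmn}e_n$ for $l\ne m$ in $\{1,\dots,7\}$, where $\epsilon_{lmn}$ is completely antisymmetric, equal to $1$ on $(1,2,3),(1,4,5),(1,7,6),(2,4,6),(2,5,7),(3,4,7),(3,6,5)$, and $0$ on triples that are not permutations of these. For $x=\sum_{l=0}^7x_le_l$: $\Re(x)=x_0$, $\Im(x)=\sum_{l=1}^7x_le_l$, $|x|=(\sum x_l^2)^{1/2}$. $\mathbb{O}=\mathbb{R}^8$ carries the Euclidean topology; a domain is a nonempty connected open set. $\mathbb{S}=\{I\in\mathbb{O}:\Re(I)=0,|I|=1\}$. Slice functions. For $a\in\mathbb{R}$, $b>0$ let $\mathbb{S}(\Omega,a,b)=\{I\in\mathbb{S}: a+bI\in\Omega\}$. A function $f:\Omega\to\mathbb{O}$ is a slice function if for every connected component $\Lambda$ of any nonempty $\mathbb{S}(\Omega,a,b)$ there is $(u,v)\in\mathbb{O}^2$ with $f(a+bI)=u+Iv$ for all $I\in\Lambda$. Slice Fueter-regularity. Let $L_{mn}=x_m\frac{\partial}{\partial x_n}-x_n\frac{\partial}{\partial x_m}$ ($1\le m<n\le 7$), $\Gamma f=-\sum_{1\le m<n\le 7}e_m(e_n(L_{mn}f))$,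 $E=\sum_{l=1}^7x_l\frac{\partial}{\partial x_l}$, and $\overline{\partial}_Ff(x)=\frac{\partial f}{\partial x_0}(x)-\Im(x)^{-1}Ef(x)-\frac13\Im(x)^{-1}\Gamma f(x)$ for $x\in\Omega\setminus\mathbb{R}$. A slice function $f:\Omega\to\mathbb{O}$ of class $\mathcal{C}^1$ (in the real variables $x_0,\dots,x_7$) is slice Fueter-regular if $\overline{\partial}_Ff\equiv0$ on $\Omega\setminus\mathbb{R}$. *)

theory Defs
  imports "HOL-Analysis.Analysis"
begin

text \<open>
  The carrier is \<open>real ^ 8\<close>, so that norm and topology are the Euclidean ones.  The index type
  \<open>8\<close> has the elements \<open>0, \<dots>, 7\<close>; coordinates are addressed by natural numbers below \<open>8\<close>.
  The library operations \<open>*\<close> and \<open>1\<close> on \<open>real ^ 8\<close> are componentwise and are \<^emph>\<open>not\<close> the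
  octonion product and unit; the product is \<open>\<odot>\<close> and the unit is \<open>oct_e 0\<close>.
\<close>

type_synonym octonion = "real ^ 8"

definition oct_coord :: "octonion \<Rightarrow> nat \<Rightarrow> real" where
  "oct_coord x l = x $ (of_nat l :: 8)"

definition oct_e :: "nat \<Rightarrow> octonion" where
  "oct_e l = axis (of_nat l :: 8) 1"

definition oct_triples :: "(nat \<times> nat \<times> nat) set" where
  "oct_triples = {(1,2,3), (1,4,5), (1,7,6), (2,4,6), (2,5,7), (3,4,7), (3,6,5)}"

text \<open>The completely antisymmetric extension of the function that is \<open>1\<close> on \<open>oct_triples\<close>.\<close>

definition oct_eps :: "nat \<Rightarrow> nat \<Rightarrow> nat \<Rightarrow> real" where
  "oct_eps l m n =
    (if (l,m,n) \<in> oct_triples \<or> (m,n,l) \<in> oct_triples \<or> (n,l,m) \<in> oct_triples then 1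
     else if (m,l,n) \<in> oct_triples \<or> (l,n,m) \<in> oct_triples \<or> (n,m,l) \<in> oct_triples then -1
     else 0)"

definition oct_basis_mult :: "nat \<Rightarrow> nat \<Rightarrow> octonion" where
  "oct_basis_mult l m =
    (if l = 0 then oct_e m
     else if m = 0 then oct_e l
     else if l = m then - oct_e 0
     else (\<Sum>n=1..7. oct_eps l m n *\<^sub>R oct_e n))"

definition oct_mult :: "octonion \<Rightarrow> octonion \<Rightarrow> octonion" (infixl "\<odot>" 70) where
  "x \<odot> y = (\<Sum>l=0..7. \<Sum>m=0..7. (oct_coord x l * oct_coord y m) *\<^sub>R oct_basis_mult l m)"

definition oct_Re :: "octonion \<Rightarrow> real" where
  "oct_Re x = oct_coord x 0"

definition oct_Im :: "octonion \<Rightarrow> octonion" where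
  "oct_Im x = (\<Sum>l=1..7. oct_coord x l *\<^sub>R oct_e l)"

definition oct_cnj :: "octonion \<Rightarrow> octonion" where
  "oct_cnj x = oct_Re x *\<^sub>R oct_e 0 - oct_Im x"

definition oct_inverse :: "octonion \<Rightarrow> octonion" where
  "oct_inverse x = (1 / (norm x)\<^sup>2) *\<^sub>R oct_cnj x"

definition oct_reals :: "octonion set" where
  "oct_reals = range (\<lambda>r. r *\<^sub>R oct_e 0)"

definition oct_sphere :: "octonion set" where
  "oct_sphere = {I. oct_Re I = 0 \<and> norm I = 1}"

lemma inj_of_nat_8: "inj_on (of_nat :: nat \<Rightarrow> 8) {0..7}"
  by (auto simp: inj_on_def atLeastAtMost_upt upt_rec numeral_eq_Suc)

lemma UNIV_8: "(UNIV :: 8 set) = of_nat ` {0..7}"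
proof -
  have "card ((of_nat :: nat \<Rightarrow> 8) ` {0..7}) = CARD(8)"
    using inj_of_nat_8 by (simp add: card_image)
  then show ?thesis
    by (metis card_subset_eq finite subset_UNIV)
qed

lemma sum_0_7: "(\<Sum>i=0..7::nat. f i) = f 0 + f 1 + f 2 + f 3 + f 4 + f 5 + f 6 + (f 7 :: 'a::comm_monoid_add)"
  and sum_1_7: "(\<Sum>i=1..7::nat. f i) = f 1 + f 2 + f 3 + f 4 + f 5 + f 6 + f 7"
  by (simp_all add: numeral_eq_Suc add.assoc)

lemma oct_coord_oct_e:
  assumes "i \<le> 7" "j \<le> 7"
  shows "oct_coord (oct_e i) j = (if i = j then 1 else 0)"
proof -
  have "(of_nat i :: 8) = of_nat j \<longleftrightarrow> i = j"
    using assms inj_of_nat_8 by (auto simp: inj_on_def)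
  then show ?thesis by (auto simp: oct_coord_def oct_e_def axis_def)
qed

lemma oct_eqI: "(\<And>i. i \<le> 7 \<Longrightarrow> oct_coord x i = oct_coord y i) \<Longrightarrow> x = y"
  by (simp add: vec_eq_iff oct_coord_def) (metis UNIV_8 UNIV_I atLeastAtMost_iff image_iff)

lemma norm_oct: "(norm x)\<^sup>2 = (\<Sum>l=0..7. (oct_coord x l)\<^sup>2)"
proof -
  have "(norm x)\<^sup>2 = (\<Sum>i\<in>UNIV. (x $ i)\<^sup>2)"
    by (simp add: norm_vec_def L2_set_def sum_nonneg)
  also have "\<dots> = (\<Sum>l=0..7. (oct_coord x l)\<^sup>2)"
    unfolding UNIV_8 by (subst sum.reindex[OF inj_of_nat_8]) (simp add: oct_coord_def)
  finally show ?thesis .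
qed

lemma oct_coord_simps:
  "oct_coord (x + y) i = oct_coord x i + oct_coord y i"
  "oct_coord (x - y) i = oct_coord x i - oct_coord y i"
  "oct_coord (- x) i = - oct_coord x i"
  "oct_coord (r *\<^sub>R x) i = r * oct_coord x i"
  "oct_coord 0 i = 0"
  "oct_coord (sum g A) i = (\<Sum>j\<in>A. oct_coord (g j) i)"
  by (simp_all add: oct_coord_def)

lemma oct_coord_basis_mult:
  assumes "l \<le> 7" "m \<le> 7" "i \<le> 7"
  shows "oct_coord (oct_basis_mult l m) i =
    (if l = 0 then (if m = i then 1 else 0) else if m = 0 then (if l = i then 1 else 0)
     else if l = m then (if i = 0 then -1 else 0) else if i = 0 then 0 else oct_eps l m i)"
proof -
  have "oct_coord (\<Sum>n=1..7. oct_eps l m n *\<^sub>R oct_e n) i = (\<Sum>n=1..7. if n = i then oct_eps l m n else 0)"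
    unfolding oct_coord_simps by (rule sum.cong) (use assms in \<open>auto simp: oct_coord_oct_e\<close>)
  also have "\<dots> = (if i = 0 then 0 else oct_eps l m i)"
    using assms by (simp add: sum.delta)
  finally show ?thesis
    using assms by (auto simp: oct_basis_mult_def oct_coord_oct_e oct_coord_simps)
qed

lemma oct_mult_cnj: "x \<odot> oct_cnj x = (norm x)\<^sup>2 *\<^sub>R oct_e 0"
proof (rule oct_eqI)
  fix i :: nat assume i: "i \<le> 7"
  have c: "oct_coord (oct_cnj x) m = (if m = 0 then oct_coord x 0 else - oct_coord x m)" if "m \<le> 7" for m
  proof -
    have "m \<in> {0,1,2,3,4,5,6,7}" using that by auto
    then show ?thesis
      by (elim insertE emptyE) (simp_all only: oct_cnj_def oct_Re_def oct_Im_def sum_1_7, simp_all add: oct_coord_simps oct_coord_oct_e)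
  qed
  have "oct_coord (x \<odot> oct_cnj x) i = (\<Sum>l=0..7. \<Sum>m=0..7. (oct_coord x l * (if m = 0 then oct_coord x 0 else - oct_coord x m)) * (if l = 0 then (if m = i then 1 else 0) else if m = 0 then (if l = i then 1 else 0)
     else if l = m then (if i = 0 then -1 else 0) else if i = 0 then 0 else oct_eps l m i))"
    unfolding oct_mult_def oct_coord_simps
    by (intro sum.cong refl) (use i in \<open>simp add: c oct_coord_basis_mult\<close>)
  also have "\<dots> = oct_coord ((norm x)\<^sup>2 *\<^sub>R oct_e 0) i"
  proof -
    have "i \<in> {0,1,2,3,4,5,6,7}" using i by auto
    then show ?thesis
      unfolding sum_0_7 norm_oct oct_coord_simps
      by (elim insertE emptyE) (simp_all add: oct_coord_oct_e oct_eps_def oct_triples_def power2_eq_square)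
  qed
  finally show "oct_coord (x \<odot> oct_cnj x) i = oct_coord ((norm x)\<^sup>2 *\<^sub>R oct_e 0) i" .
qed

lemma oct_mult_inverse:
  assumes "x \<noteq> 0"
  shows "x \<odot> oct_inverse x = oct_e 0"
proof -
  have "x \<odot> (r *\<^sub>R y) = r *\<^sub>R (x \<odot> y)" for r y
    by (simp add: oct_mult_def oct_coord_simps scaleR_sum_right ac_simps)
  then show ?thesis
    using assms by (simp add: oct_inverse_def oct_mult_cnj)
qed

text \<open>
  The functions of type \<open>'n \<Rightarrow> nat\<close> are the multi-indices.  For values in a finite-dimensional
  space, \<open>has_sum\<close> is absolute convergence of the power series.
\<close>

definition real_analytic_on :: "(real ^ 'n \<Rightarrow> 'b::real_normed_vector) \<Rightarrow> (real ^ 'n) set \<Rightarrow> bool"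
    (infix "(real'_analytic'_on)" 50) where
  "f real_analytic_on S \<longleftrightarrow>
    (\<forall>a\<in>S. \<exists>r>0. \<exists>c :: ('n \<Rightarrow> nat) \<Rightarrow> 'b. ball a r \<subseteq> S \<and>
      (\<forall>x\<in>ball a r.
        ((\<lambda>\<alpha>. (\<Prod>i\<in>UNIV. (x $ i - a $ i) ^ \<alpha> i) *\<^sub>R c \<alpha>) has_sum f x) UNIV))"

definition continuously_differentiable_on ::
    "('a::real_normed_vector \<Rightarrow> 'b::real_normed_vector) \<Rightarrow> 'a set \<Rightarrow> bool"
    (infix "(continuously'_differentiable'_on)" 50) where
  "f continuously_differentiable_on S \<longleftrightarrow>
    (\<exists>f' :: 'a \<Rightarrow> 'a \<Rightarrow>\<^sub>L 'b.
      (\<forall>x\<in>S. (f has_derivative blinfun_apply (f' x)) (at x)) \<and> continuous_on S f')"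

definition oct_partial :: "nat \<Rightarrow> (octonion \<Rightarrow> octonion) \<Rightarrow> octonion \<Rightarrow> octonion" where
  "oct_partial l f x = vector_derivative (\<lambda>t. f (x + t *\<^sub>R oct_e l)) (at 0)"

definition slice_sphere :: "octonion set \<Rightarrow> real \<Rightarrow> real \<Rightarrow> octonion set" where
  "slice_sphere \<Omega> a b = {I \<in> oct_sphere. a *\<^sub>R oct_e 0 + b *\<^sub>R I \<in> \<Omega>}"

definition slice_function :: "octonion set \<Rightarrow> (octonion \<Rightarrow> octonion) \<Rightarrow> bool" where
  "slice_function \<Omega> f \<longleftrightarrow>
    (\<forall>a b. b > 0 \<longrightarrow> (\<forall>\<Lambda> \<in> components (slice_sphere \<Omega> a b).
      \<exists>u v. \<forall>I\<in>\<Lambda>. f (a *\<^sub>R oct_e 0 + b *\<^sub>R I) = u + I \<odot> v))"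

definition L_op :: "nat \<Rightarrow> nat \<Rightarrow> (octonion \<Rightarrow> octonion) \<Rightarrow> octonion \<Rightarrow> octonion" where
  "L_op m n f x = oct_coord x m *\<^sub>R oct_partial n f x - oct_coord x n *\<^sub>R oct_partial m f x"

definition Gamma_op :: "(octonion \<Rightarrow> octonion) \<Rightarrow> octonion \<Rightarrow> octonion" where
  "Gamma_op f x = - (\<Sum>m=1..7. \<Sum>n=m+1..7. oct_e m \<odot> (oct_e n \<odot> L_op m n f x))"

definition E_op :: "(octonion \<Rightarrow> octonion) \<Rightarrow> octonion \<Rightarrow> octonion" where
  "E_op f x = (\<Sum>l=1..7. oct_coord x l *\<^sub>R oct_partial l f x)"

definition dbar_F :: "(octonion \<Rightarrow> octonion) \<Rightarrow> octonion \<Rightarrow> octonion" where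
  "dbar_F f x = oct_partial 0 f x
     - oct_inverse (oct_Im x) \<odot> E_op f x
     - (1/3) *\<^sub>R (oct_inverse (oct_Im x) \<odot> Gamma_op f x)"

definition slice_Fueter_regular :: "octonion set \<Rightarrow> (octonion \<Rightarrow> octonion) \<Rightarrow> bool" where
  "slice_Fueter_regular \<Omega> f \<longleftrightarrow>
    slice_function \<Omega> f \<and> f continuously_differentiable_on \<Omega> \<and>
    (\<forall>x \<in> \<Omega> - oct_reals. dbar_F f x = 0)"

end

theory Submission
  imports Defs "HOL-Complex_Analysis.Complex_Analysis"
begin

text \<open>
  Locally \<open>f (a + b I) = u (a, b) + I v (a, b)\<close>, and \<open>\<Gamma> (I v) = 6 I v\<close> turns Fueter regularity into
  the system \<open>v\<^sub>a = - u\<^sub>b\<close>, \<open>b u\<^sub>a = b v\<^sub>b + 2 v\<close>.  The first equation says that \<open>- u da + v db\<close> has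
  a potential \<open>K\<close>, and the second one that \<open>\<Psi> = K + b v - i b u\<close> is holomorphic in \<open>a + i b\<close>.  With a
  primitive \<open>\<Phi>\<close> of \<open>\<Psi>\<close> such that \<open>Im \<Phi> = b K\<close> one has \<open>b u = - Im \<Phi>'\<close> and \<open>b\<^sup>2 v = b Re \<Phi>' - Im \<Phi>\<close>.
  Off the real axis \<open>f\<close> is therefore a composition of analytic functions.  At a real point \<open>u\<close> is even
  and \<open>v\<close> is odd in \<open>b\<close>, and \<open>u\<close> and \<open>v / b\<close> expand into power series in \<open>a\<close> and
  \<open>b\<^sup>2 = x\<^sub>1\<^sup>2 + \<dots> + x\<^sub>7\<^sup>2\<close>.
\<close>

section \<open>Weighted absolutely convergent power series\<close>

text \<open>Each imaginary unit lies in six of the pairs over which \<open>\<Gamma>\<close> sums,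
  hence the 6; with the factor 1/3 in \<open>dbar_F\<close> it becomes the term
  \<open>2 v / b\<close>. Associativity is replaced by \<open>a (a v) = - |a|^2 v\<close> for
  imaginary \<open>a\<close>. Regularity reads \<open>A + I B = 0\<close> with \<open>A\<close>,
  \<open>B\<close> independent of \<open>I\<close>, and two different units already force
  \<open>A = B = 0\<close>. The obstacle is the real axis, where \<open>|Im x|\<close> is not smooth
  and \<open>dbar_F\<close> is not imposed. It is crossed in the plane: the slices of
  \<open>J\<close> and \<open>- J\<close> define \<open>u\<close> and \<open>v\<close> on a whole
  disc, parity under conjugation carries the system to the lower half, and in the form
  \<open>b u_a = b v_b + 2 v\<close> it also holds on the axis, because \<open>v\<close>,
  \<open>v_a\<close> and \<open>u_b\<close> vanish there. So \<open>\<Phi>\<close> is holomorphic on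
  the full disc. Analyticity in the eight variables is measured by a weighted norm of complex
  coefficients, since holomorphic functions are to be composed with functions of these variables and
  infinite series of polynomials are to be summed.\<close>

definition monom_at :: "real ^ 'n \<Rightarrow> real ^ 'n \<Rightarrow> ('n \<Rightarrow> nat) \<Rightarrow> real" where
  "monom_at a x \<alpha> = (\<Prod>i\<in>UNIV. (x $ i - a $ i) ^ \<alpha> i)"

definition mdeg :: "('n::finite \<Rightarrow> nat) \<Rightarrow> nat" where
  "mdeg \<alpha> = sum \<alpha> UNIV"

definition cube :: "real ^ 'n \<Rightarrow> real \<Rightarrow> (real ^ 'n) set" where
  "cube a r = {x. \<forall>i. \<bar>x $ i - a $ i\<bar> \<le> r}"

text \<open>A weighted l1 norm of the coefficients, of which \<open>M\<close> is only an upper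
  bound. It dominates the supremum on \<open>cube a r\<close>, where a monomial is at most
  \<open>r ^ mdeg \<alpha>\<close>, and it is submultiplicative; so sums, products and powers can be
  estimated without knowing coefficients.\<close>

definition series_bound :: "real ^ 'n \<Rightarrow> real \<Rightarrow> real \<Rightarrow> (real ^ 'n \<Rightarrow> complex) \<Rightarrow> bool" where
  "series_bound a r M g \<longleftrightarrow> (\<exists>c. \<exists>S\<le>M.
     ((\<lambda>\<alpha>. norm (c \<alpha>) * r ^ mdeg \<alpha>) has_sum S) UNIV \<and>
     (\<forall>x\<in>cube a r. ((\<lambda>\<alpha>. monom_at a x \<alpha> *\<^sub>R c \<alpha>) has_sum g x) UNIV))"

definition analytic_near :: "real ^ 'n \<Rightarrow> (real ^ 'n \<Rightarrow> complex) \<Rightarrow> bool" where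
  "analytic_near a g \<longleftrightarrow> (\<exists>r>0. \<exists>M. series_bound a r M g)"

lemma norm_monom_at_le:
  assumes "x \<in> cube a r"
  shows "\<bar>monom_at a x \<alpha>\<bar> \<le> r ^ mdeg \<alpha>"
proof -
  have "\<bar>monom_at a x \<alpha>\<bar> = (\<Prod>i\<in>UNIV. \<bar>x $ i - a $ i\<bar> ^ \<alpha> i)"
    by (simp add: monom_at_def abs_prod power_abs)
  also have "\<dots> \<le> (\<Prod>i\<in>UNIV. r ^ \<alpha> i)"
    using assms by (intro prod_mono) (auto simp: cube_def intro: power_mono)
  finally show ?thesis by (simp add: mdeg_def power_sum)
qed

lemma norm_monom_at_scaleR_le:
  "x \<in> cube a r \<Longrightarrow> norm (monom_at a x \<alpha> *\<^sub>R z) \<le> norm z * r ^ mdeg \<alpha>"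
  using norm_monom_at_le[of x a r \<alpha>] by (simp add: mult.commute mult_left_mono)

lemma monom_at_add: "monom_at a x (\<lambda>i. \<alpha> i + \<beta> i) = monom_at a x \<alpha> * monom_at a x \<beta>"
  by (simp add: monom_at_def power_add prod.distrib)

lemma mdeg_add: "mdeg (\<lambda>i. \<alpha> i + \<beta> i) = mdeg \<alpha> + mdeg \<beta>"
  by (simp add: mdeg_def sum.distrib)

lemma mdeg_eq_0_iff: "mdeg \<alpha> = 0 \<longleftrightarrow> \<alpha> = (\<lambda>_. 0)"
  by (auto simp: mdeg_def fun_eq_iff)

lemma series_bound_nonneg: "series_bound a r M g \<Longrightarrow> r \<ge> 0 \<Longrightarrow> M \<ge> 0"
  unfolding series_bound_def by (smt (verit) has_sum_nonneg norm_ge_zero zero_le_mult_iff zero_le_power)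

lemma series_bound_mono: "series_bound a r M g \<Longrightarrow> M \<le> N \<Longrightarrow> series_bound a r N g"
  unfolding series_bound_def by (meson order_trans)

lemma series_bound_coeffsI:
  assumes "S \<le> M" "((\<lambda>\<alpha>. norm (c \<alpha>) * r ^ mdeg \<alpha>) has_sum S) UNIV"
    and "\<And>x. x \<in> cube a r \<Longrightarrow> ((\<lambda>\<alpha>. monom_at a x \<alpha> *\<^sub>R c \<alpha>) has_sum g x) UNIV"
  shows "series_bound a r M g"
  unfolding series_bound_def using assms by (intro exI[of _ c] exI[of _ S]) auto

lemma series_bound_norm_le:
  assumes "series_bound a r M g" and "x \<in> cube a r"
  shows "norm (g x) \<le> M"
proof -
  obtain c S where S: "S \<le> M" "((\<lambda>\<alpha>. norm (c \<alpha>) * r ^ mdeg \<alpha>) has_sum S) UNIV"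
    "((\<lambda>\<alpha>. monom_at a x \<alpha> *\<^sub>R c \<alpha>) has_sum g x) UNIV"
    using assms unfolding series_bound_def by blast
  show ?thesis
    using norm_infsum_le[OF S(3,2) norm_monom_at_scaleR_le[OF assms(2)]] S(1) by simp
qed

text \<open>Series indexed by an arbitrary type may be regrouped by monomials; sums and products of
  series then need no bookkeeping of coefficients.\<close>

lemma series_boundI:
  fixes c :: "'j \<Rightarrow> complex" and \<beta> :: "'j \<Rightarrow> 'n::finite \<Rightarrow> nat"
  assumes r: "r > 0"
    and S: "((\<lambda>j. norm (c j) * r ^ mdeg (\<beta> j)) has_sum S) UNIV" "S \<le> M"
    and g: "\<And>x. x \<in> cube a r \<Longrightarrow> ((\<lambda>j. monom_at a x (\<beta> j) *\<^sub>R c j) has_sum g x) UNIV"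
  shows "series_bound a r M g"
proof -
  \<comment> \<open>\<open>F \<alpha>\<close> is the fibre of \<open>\<beta>\<close> over
    \<open>\<alpha>\<close>; the index type is the disjoint union of these fibres.\<close>
  define F where "F = (\<lambda>\<alpha>. {j. \<beta> j = \<alpha>})"
  have bij: "bij_betw (\<lambda>j. (\<beta> j, j)) UNIV (Sigma UNIV F)"
    by (rule bij_betwI[where g = snd]) (auto simp: F_def)
  have Sig: "(h \<circ> snd has_sum s) (Sigma UNIV F)" if "(h has_sum s) UNIV" for h :: "'j \<Rightarrow> 'z::real_normed_vector" and s
    using has_sum_reindex_bij_betw[OF bij, of "h \<circ> snd" s] that by (simp add: o_def)
  have "(\<lambda>j. norm (c j)) summable_on F \<alpha>" for \<alpha>
  proof -
    have "(\<lambda>j. norm (c j) * r ^ mdeg (\<beta> j)) summable_on F \<alpha>"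
      using S(1) has_sum_imp_summable summable_on_subset_banach by blast
    then have "(\<lambda>j. norm (c j) * r ^ mdeg \<alpha>) summable_on F \<alpha>"
      by (rule summable_on_cong[THEN iffD1, rotated]) (auto simp: F_def)
    then show ?thesis using r by (subst (asm) summable_on_cmult_left') auto
  qed note abs = this
  have N: "((\<lambda>j. norm (c j)) has_sum infsum (\<lambda>j. norm (c j)) (F \<alpha>)) (F \<alpha>)" for \<alpha>
    using abs by simp
  have C: "(c has_sum infsum c (F \<alpha>)) (F \<alpha>)" for \<alpha>
    using abs[of \<alpha>] by (simp add: abs_summable_summable)
  have 1: "((\<lambda>\<alpha>. infsum (\<lambda>j. norm (c j)) (F \<alpha>) * r ^ mdeg \<alpha>) has_sum S) UNIV"
  proof (rule has_sum_SigmaD[OF Sig[OF S(1)]])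
    fix \<alpha>
    show "((\<lambda>y. ((\<lambda>j. norm (c j) * r ^ mdeg (\<beta> j)) \<circ> snd) (\<alpha>, y)) has_sum infsum (\<lambda>j. norm (c j)) (F \<alpha>) * r ^ mdeg \<alpha>) (F \<alpha>)"
      by (rule has_sum_cong[THEN iffD2, OF _ has_sum_cmult_left[OF N[of \<alpha>], of "r ^ mdeg \<alpha>"]]) (simp add: F_def)
  qed
  have 2: "((\<lambda>\<alpha>. monom_at a x \<alpha> *\<^sub>R infsum c (F \<alpha>)) has_sum g x) UNIV" if "x \<in> cube a r" for x
  proof (rule has_sum_SigmaD[OF Sig[OF g[OF that]]])
    fix \<alpha>
    show "((\<lambda>y. ((\<lambda>j. monom_at a x (\<beta> j) *\<^sub>R c j) \<circ> snd) (\<alpha>, y)) has_sum monom_at a x \<alpha> *\<^sub>R infsum c (F \<alpha>)) (F \<alpha>)"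
      by (rule has_sum_cong[THEN iffD2, OF _ has_sum_scaleR[OF C[of \<alpha>], of "monom_at a x \<alpha>"]]) (simp add: F_def)
  qed
  \<comment> \<open>Cancellation inside a fibre can only decrease the norm, so \<open>S\<close>
    survives as an upper bound and not as the exact value.\<close>
  have le: "norm (infsum c (F \<alpha>)) * r ^ mdeg \<alpha> \<le> infsum (\<lambda>j. norm (c j)) (F \<alpha>) * r ^ mdeg \<alpha>" for \<alpha>
    using norm_infsum_bound[OF abs[of \<alpha>]] r by (intro mult_right_mono) auto
  have "(\<lambda>\<alpha>. norm (infsum c (F \<alpha>)) * r ^ mdeg \<alpha>) summable_on UNIV"
    by (rule summable_on_comparison_test[OF has_sum_imp_summable[OF 1]]) (use le r in auto)
  then obtain T where T: "((\<lambda>\<alpha>. norm (infsum c (F \<alpha>)) * r ^ mdeg \<alpha>) has_sum T) UNIV"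
    using summable_iff_has_sum_infsum by blast
  have "T \<le> M" using has_sum_mono[OF T 1] le S(2) by force
  then show ?thesis using T 2 by (rule series_bound_coeffsI)
qed

lemma series_bound_const: "r \<ge> 0 \<Longrightarrow> series_bound a r (norm k) (\<lambda>_. k)"
  unfolding series_bound_def
proof (intro exI[of _ "\<lambda>\<alpha>. if \<alpha> = (\<lambda>_. 0) then k else 0"] exI[of _ "norm k"] conjI ballI order_refl)
  show "((\<lambda>\<alpha>. norm (if \<alpha> = (\<lambda>_. 0) then k else 0) * r ^ mdeg \<alpha>) has_sum norm k) UNIV"
    by (rule has_sum_finite_neutralI[of "{\<lambda>_. 0}"]) (auto simp: mdeg_def)
  show "((\<lambda>\<alpha>. monom_at a x \<alpha> *\<^sub>R (if \<alpha> = (\<lambda>_. 0) then k else 0)) has_sum k) UNIV" for x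
    by (rule has_sum_finite_neutralI[of "{\<lambda>_. 0}"]) (auto simp: monom_at_def)
qed

lemma series_bound_coord: "r \<ge> 0 \<Longrightarrow> series_bound a r r (\<lambda>x. of_real (x $ i - a $ i))"
  unfolding series_bound_def
proof (intro exI[of _ "\<lambda>\<alpha>. if \<alpha> = (\<lambda>j. if j = i then 1 else 0) then 1 else 0"] exI[of _ r] conjI ballI order_refl)
  let ?d = "\<lambda>j. if j = i then 1 else (0::nat)"
  show "((\<lambda>\<alpha>. norm (if \<alpha> = ?d then 1 else 0 :: complex) * r ^ mdeg \<alpha>) has_sum r) UNIV"
    by (rule has_sum_finite_neutralI[of "{?d}"]) (auto simp: mdeg_def)
  have "monom_at a x ?d = x $ i - a $ i" for x
    by (simp add: monom_at_def if_distrib[of "\<lambda>n. _ ^ n"] cong: if_cong)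
  then show "((\<lambda>\<alpha>. monom_at a x \<alpha> *\<^sub>R (if \<alpha> = ?d then 1 else 0)) has_sum complex_of_real (x $ i - a $ i)) UNIV" for x
    by (intro has_sum_finite_neutralI[of "{?d}"]) (auto simp: scaleR_conv_of_real)
qed

text \<open>The coefficients of all \<open>g n\<close> form one family indexed by pairs
  \<open>(n, \<alpha>)\<close>, whose majorant is summable because the inner sums are at most
  \<open>M n\<close>. Regrouping along \<open>snd\<close> adds up the coefficients of equal
  monomials.\<close>

lemma series_bound_sums:
  fixes g :: "nat \<Rightarrow> real ^ 'n \<Rightarrow> complex"
  assumes r: "r > 0" and g: "\<And>n. series_bound a r (M n) (g n)" and M: "summable M"
    and G: "\<And>x. x \<in> cube a r \<Longrightarrow> (\<lambda>n. g n x) sums G x"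
  shows "series_bound a r (suminf M) G"
proof -
  define P where "P n c S \<longleftrightarrow> S \<le> M n \<and> ((\<lambda>\<alpha>. norm (c \<alpha>) * r ^ mdeg \<alpha>) has_sum S) UNIV \<and>
    (\<forall>x\<in>cube a r. ((\<lambda>\<alpha>. monom_at a x \<alpha> *\<^sub>R c \<alpha>) has_sum g n x) UNIV)" for n and c :: "('n \<Rightarrow> nat) \<Rightarrow> complex" and S
  have "\<forall>n. \<exists>c S. P n c S"
    using g unfolding series_bound_def P_def by blast
  then obtain c S where "\<And>n. P n (c n) (S n)"
    by metis
  then have c: "\<And>n. S n \<le> M n" "\<And>n. ((\<lambda>\<alpha>. norm (c n \<alpha>) * r ^ mdeg \<alpha>) has_sum S n) UNIV"
    "\<And>n x. x \<in> cube a r \<Longrightarrow> ((\<lambda>\<alpha>. monom_at a x \<alpha> *\<^sub>R c n \<alpha>) has_sum g n x) UNIV"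
    unfolding P_def by auto
  have S0: "0 \<le> S n" for n
    by (rule has_sum_nonneg[OF c(2)]) (use r in auto)
  have sS: "summable S"
    by (rule summable_comparison_test'[OF M, of 0]) (use S0 c(1) in auto)
  have hS: "(S has_sum suminf S) UNIV"
    using S0 sS by (intro sums_nonneg_imp_has_sum) auto
  have le: "suminf S \<le> suminf M"
    by (intro suminf_le c(1) sS M)
  have sum1: "(\<lambda>(n, \<alpha>). norm (c n \<alpha>) * r ^ mdeg \<alpha>) summable_on UNIV"
    using summable_on_SigmaI[where A = UNIV and f = "\<lambda>(n, \<alpha>). norm (c n \<alpha>) * r ^ mdeg \<alpha>" and g = S and B = "\<lambda>_. UNIV"] c(2) has_sum_imp_summable[OF hS] r
    by auto
  have 1: "((\<lambda>(n, \<alpha>). norm (c n \<alpha>) * r ^ mdeg \<alpha>) has_sum suminf S) UNIV"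
    using has_sum_SigmaI[where A = UNIV and f = "\<lambda>(n, \<alpha>). norm (c n \<alpha>) * r ^ mdeg \<alpha>" and g = S and B = "\<lambda>_. UNIV"] c(2) hS sum1
    by auto
  have 2: "((\<lambda>(n, \<alpha>). monom_at a x \<alpha> *\<^sub>R c n \<alpha>) has_sum G x) UNIV" if x: "x \<in> cube a r" for x
  proof -
    have "(\<lambda>(n, \<alpha>). monom_at a x \<alpha> *\<^sub>R c n \<alpha>) summable_on UNIV"
      by (rule abs_summable_summable, rule Infinite_Sum.abs_summable_on_comparison_test'[OF sum1])
         (simp add: case_prod_unfold norm_monom_at_scaleR_le[OF x] del: norm_scaleR)
    moreover have "norm (g n x) \<le> M n" for n
      using series_bound_norm_le[OF g x] .
    then have "summable (\<lambda>n. norm (g n x))"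
      by (intro summable_comparison_test'[OF M, of 0]) auto
    then have "((\<lambda>n. g n x) has_sum G x) UNIV"
      by (rule norm_summable_imp_has_sum[OF _ G[OF x]])
    ultimately show ?thesis
      using has_sum_SigmaI[where A = UNIV and f = "\<lambda>(n, \<alpha>). monom_at a x \<alpha> *\<^sub>R c n \<alpha>" and g = "\<lambda>n. g n x" and B = "\<lambda>_. UNIV"] c(3)[OF x]
      by auto
  qed
  show ?thesis
    by (rule series_boundI[where c = "\<lambda>(n, \<alpha>). c n \<alpha>" and \<beta> = snd, OF r _ le])
       (use 1 2 in \<open>simp_all add: case_prod_unfold\<close>)
qed

lemma series_bound_add:
  assumes r: "r > 0" and g: "series_bound a r M g" and h: "series_bound a r N h"
  shows "series_bound a r (M + N) (\<lambda>x. g x + h x)"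
proof -
  have z: "series_bound a r 0 (\<lambda>_. 0)" using series_bound_const[of r a 0] r by simp
  \<comment> \<open>A sum of two functions is treated as a series with zeros from the third term
    on.\<close>
  define m where "m = (\<lambda>n::nat. if n = 0 then M else if n = 1 then N else 0)"
  define p where "p = (\<lambda>n::nat. if n = 0 then g else if n = 1 then h else (\<lambda>_. 0))"
  have *: "series_bound a r (m n) (p n)" for n
    using g h z by (auto simp: m_def p_def)
  have fin: "(\<lambda>n::nat. if n = 0 then y else if n = 1 then z else 0) sums (y + z)" for y z :: "'z::real_normed_vector"
    using sums_finite[of "{0,1::nat}" "\<lambda>n::nat. if n = 0 then y else if n = 1 then z else 0"] by auto
  have m: "m sums (M + N)"
    using fin[of M N] by (simp add: m_def)
  have "(\<lambda>n. p n x) sums (g x + h x)" for x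
    using fin[of "g x" "h x"] by (simp add: p_def if_distrib[of "\<lambda>f. f x"] cong: if_cong)
  then show ?thesis
    using series_bound_sums[where g = p and M = m and G = "\<lambda>x. g x + h x", OF r *] m by (simp add: sums_iff)
qed

text \<open>The Cauchy product, left as a family over pairs of multi-indices;
  \<open>\<alpha> + \<beta>\<close> is the exponent of the product monomial, and the majorant
  factors into \<open>S * T\<close>.\<close>

lemma series_bound_mult:
  assumes r: "r > 0" and g: "series_bound a r M g" and h: "series_bound a r N h"
  shows "series_bound a r (M * N) (\<lambda>x. g x * h x)"
proof -
  obtain c S where c: "S \<le> M" "((\<lambda>\<alpha>. norm (c \<alpha>) * r ^ mdeg \<alpha>) has_sum S) UNIV"
    "\<And>x. x \<in> cube a r \<Longrightarrow> ((\<lambda>\<alpha>. monom_at a x \<alpha> *\<^sub>R c \<alpha>) has_sum g x) UNIV"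
    using g unfolding series_bound_def by metis
  obtain d T where d: "T \<le> N" "((\<lambda>\<alpha>. norm (d \<alpha>) * r ^ mdeg \<alpha>) has_sum T) UNIV"
    "\<And>x. x \<in> cube a r \<Longrightarrow> ((\<lambda>\<alpha>. monom_at a x \<alpha> *\<^sub>R d \<alpha>) has_sum h x) UNIV"
    using h unfolding series_bound_def by metis
  have S0: "S \<ge> 0" "T \<ge> 0" using has_sum_nonneg[OF c(2)] has_sum_nonneg[OF d(2)] r by auto
  let ?n = "\<lambda>(\<alpha>, \<beta>). (norm (c \<alpha>) * r ^ mdeg \<alpha>) * (norm (d \<beta>) * r ^ mdeg \<beta>)"
  let ?m = "\<lambda>x (\<alpha>, \<beta>). (monom_at a x \<alpha> *\<^sub>R c \<alpha>) * (monom_at a x \<beta> *\<^sub>R d \<beta>)"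
  have inner: "((\<lambda>\<beta>. ?n (\<alpha>, \<beta>)) has_sum (norm (c \<alpha>) * r ^ mdeg \<alpha>) * T) UNIV" for \<alpha>
    using has_sum_cmult_right[OF d(2)] by simp
  have outer: "((\<lambda>\<alpha>. (norm (c \<alpha>) * r ^ mdeg \<alpha>) * T) has_sum S * T) UNIV"
    using has_sum_cmult_left[OF c(2)] by simp
  have sum1: "?n summable_on UNIV"
    using summable_on_SigmaI[where A = UNIV and f = ?n and B = "\<lambda>_. UNIV", OF inner has_sum_imp_summable[OF outer]] r by auto
  have 1: "(?n has_sum S * T) UNIV"
    using has_sum_SigmaI[where A = UNIV and f = ?n and B = "\<lambda>_. UNIV", OF inner outer] sum1 by auto
  have 2: "(?m x has_sum g x * h x) UNIV" if x: "x \<in> cube a r" for x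
  proof -
    have "norm (?m x p) \<le> ?n p" for p
      proof (cases p)
      case (Pair \<alpha> \<beta>)
      have "norm (?m x p) = norm (monom_at a x \<alpha> *\<^sub>R c \<alpha>) * norm (monom_at a x \<beta> *\<^sub>R d \<beta>)"
        by (simp only: Pair split_conv norm_mult)
      also have "\<dots> \<le> ?n p"
        unfolding Pair split_conv by (intro mult_mono norm_monom_at_scaleR_le[OF x]) (use r in auto)
      finally show ?thesis .
    qed
    then have "?m x summable_on UNIV"
      by (rule abs_summable_summable[OF Infinite_Sum.abs_summable_on_comparison_test'[OF sum1]])
    moreover have "((\<lambda>\<beta>. ?m x (\<alpha>, \<beta>)) has_sum (monom_at a x \<alpha> *\<^sub>R c \<alpha>) * h x) UNIV" for \<alpha>
      unfolding split_conv by (rule has_sum_cmult_right[OF d(3)[OF x]])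
    ultimately show ?thesis
      using has_sum_SigmaI[where A = UNIV and f = "?m x" and g = "\<lambda>\<alpha>. (monom_at a x \<alpha> *\<^sub>R c \<alpha>) * h x" and B = "\<lambda>_. UNIV"]
        has_sum_cmult_left[OF c(3)[OF x], of "h x"] by auto
  qed
  show ?thesis
    by (rule series_boundI[where c = "\<lambda>(\<alpha>, \<beta>). c \<alpha> * d \<beta>" and \<beta> = "\<lambda>(\<alpha>, \<beta>) i. \<alpha> i + \<beta> i" and S = "S * T", OF r])
      (use 1 2 S0 c(1) d(1) in \<open>simp_all add: case_prod_unfold norm_mult mdeg_add monom_at_add power_add mult_ac mult_mono\<close>)
qed

lemma series_bound_power:
  assumes r: "r > 0" and g: "series_bound a r M g"
  shows "series_bound a r (M ^ n) (\<lambda>x. g x ^ n)"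
proof (induction n)
  case 0
  then show ?case using series_bound_const[of r a 1] r by simp
next
  case (Suc n)
  then show ?case using series_bound_mult[OF r g Suc] by simp
qed

lemma series_bound_cmult:
  "r > 0 \<Longrightarrow> series_bound a r M g \<Longrightarrow> series_bound a r (norm k * M) (\<lambda>x. k * g x)"
  by (intro series_bound_mult series_bound_const) auto

lemma series_bound_sum:
  assumes "r > 0" and "\<And>j. j \<in> J \<Longrightarrow> series_bound a r (M j) (g j)"
  shows "series_bound a r (sum M J) (\<lambda>x. \<Sum>j\<in>J. g j x)"
  using assms(2)
proof (induction J rule: infinite_finite_induct)
  case (insert j J)
  then show ?case using series_bound_add[OF assms(1), of a "M j" "g j"] by auto
qed (use series_bound_const[of r a 0] assms(1) in auto)

lemma cube_mono: "s \<le> r \<Longrightarrow> cube a s \<subseteq> cube a r"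
  unfolding cube_def using order_trans by blast

lemma center_in_cube: "r \<ge> 0 \<Longrightarrow> a \<in> cube a r"
  by (simp add: cube_def)

lemma series_bound_shrink:
  assumes g: "series_bound a r M g" and s: "0 \<le> s" "s \<le> r"
  shows "series_bound a s M g"
proof -
  obtain c S where c: "S \<le> M" "((\<lambda>\<alpha>. norm (c \<alpha>) * r ^ mdeg \<alpha>) has_sum S) UNIV"
    "\<And>x. x \<in> cube a r \<Longrightarrow> ((\<lambda>\<alpha>. monom_at a x \<alpha> *\<^sub>R c \<alpha>) has_sum g x) UNIV"
    using g unfolding series_bound_def by metis
  have le: "norm (c \<alpha>) * s ^ mdeg \<alpha> \<le> norm (c \<alpha>) * r ^ mdeg \<alpha>" for \<alpha>
    using s by (intro mult_left_mono power_mono) auto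
  have "(\<lambda>\<alpha>. norm (c \<alpha>) * s ^ mdeg \<alpha>) summable_on UNIV"
    by (rule summable_on_comparison_test[OF has_sum_imp_summable[OF c(2)]]) (use le s in auto)
  then obtain T where T: "((\<lambda>\<alpha>. norm (c \<alpha>) * s ^ mdeg \<alpha>) has_sum T) UNIV"
    using summable_iff_has_sum_infsum by blast
  have "T \<le> M" using has_sum_mono[OF T c(2)] le c(1) by force
  then show ?thesis using T by (rule series_bound_coeffsI) (use c(3) cube_mono[OF s(2)] in blast)
qed

text \<open>Without a constant term every monomial has degree \<open>m \<ge> 1\<close>, and then
  \<open>(t * r) ^ m \<le> t * r ^ m\<close>. Shrinking the cube thus makes the norm as small as a
  composition requires.\<close>

lemma series_bound_scale:
  assumes g: "series_bound a r M g" and ga: "g a = 0" and r: "r > 0" and t: "0 \<le> t" "t \<le> 1"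
  shows "series_bound a (t * r) (t * M) g"
proof -
  obtain c S where c: "S \<le> M" "((\<lambda>\<alpha>. norm (c \<alpha>) * r ^ mdeg \<alpha>) has_sum S) UNIV"
    "\<And>x. x \<in> cube a r \<Longrightarrow> ((\<lambda>\<alpha>. monom_at a x \<alpha> *\<^sub>R c \<alpha>) has_sum g x) UNIV"
    using g unfolding series_bound_def by metis
  \<comment> \<open>At the centre only the constant monomial survives, because
    \<open>0 ^ 0 = 1\<close>; this identifies its coefficient with \<open>g a\<close>.\<close>
  have "monom_at a a \<alpha> = 0" if "\<alpha> \<noteq> (\<lambda>_. 0)" for \<alpha>
    using that by (auto simp: monom_at_def fun_eq_iff)
  then have "((\<lambda>\<alpha>. monom_at a a \<alpha> *\<^sub>R c \<alpha>) has_sum c (\<lambda>_. 0)) UNIV"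
    by (intro has_sum_finite_neutralI[of "{\<lambda>_. 0}"]) (auto simp: monom_at_def)
  then have c0: "c (\<lambda>_. 0) = 0"
    using has_sum_unique[OF c(3)] center_in_cube[of r a] ga r by auto
  have le: "norm (c \<alpha>) * (t * r) ^ mdeg \<alpha> \<le> t * (norm (c \<alpha>) * r ^ mdeg \<alpha>)" for \<alpha>
  proof (cases "\<alpha> = (\<lambda>_. 0)")
    case False
    then obtain m where m: "mdeg \<alpha> = Suc m" using mdeg_eq_0_iff not0_implies_Suc by blast
    have "t ^ m * (t * r ^ mdeg \<alpha>) \<le> 1 * (t * r ^ mdeg \<alpha>)"
      using t r by (intro mult_right_mono power_le_one) auto
    then have "norm (c \<alpha>) * (t ^ m * (t * r ^ mdeg \<alpha>)) \<le> norm (c \<alpha>) * (t * r ^ mdeg \<alpha>)"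
      by (intro mult_left_mono) auto
    then show ?thesis using m by (simp add: power_mult_distrib mult_ac)
  qed (simp add: c0)
  have tc: "((\<lambda>\<alpha>. t * (norm (c \<alpha>) * r ^ mdeg \<alpha>)) has_sum t * S) UNIV"
    by (rule has_sum_cmult_right[OF c(2)])
  have "(\<lambda>\<alpha>. norm (c \<alpha>) * (t * r) ^ mdeg \<alpha>) summable_on UNIV"
    by (rule summable_on_comparison_test[OF has_sum_imp_summable[OF tc]]) (use le t r in auto)
  then obtain T where T: "((\<lambda>\<alpha>. norm (c \<alpha>) * (t * r) ^ mdeg \<alpha>) has_sum T) UNIV"
    using summable_iff_has_sum_infsum by blast
  have "t * S \<le> t * M" using c(1) t by (simp add: mult_left_mono)
  then have "T \<le> t * M" using has_sum_mono[OF T tc] le by force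
  moreover have "cube a (t * r) \<subseteq> cube a r" using t r by (intro cube_mono) (simp add: mult_left_le_one_le)
  ultimately have c': "\<And>x. x \<in> cube a (t * r) \<Longrightarrow> ((\<lambda>\<alpha>. monom_at a x \<alpha> *\<^sub>R c \<alpha>) has_sum g x) UNIV" and Tt: "T \<le> t * M"
    using c(3) by blast+
  show ?thesis by (rule series_bound_coeffsI[OF Tt T c'])
qed

section \<open>Germs of analytic functions: arithmetic, composition, real and imaginary
  parts\<close>

lemma analytic_near_common:
  assumes "analytic_near a g" "analytic_near a h"
  obtains r M N where "r > 0" "series_bound a r M g" "series_bound a r N h"
proof -
  obtain r M s N where "r > 0" "s > 0" "series_bound a r M g" "series_bound a s N h"
    using assms unfolding analytic_near_def by blast
  then show thesis
    using that[of "min r s" M N] series_bound_shrink[of a r M g "min r s"] series_bound_shrink[of a s N h "min r s"] by auto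
qed

lemma analytic_near_const [intro]: "analytic_near a (\<lambda>_. k)"
  unfolding analytic_near_def using series_bound_const[of 1 a k] zero_less_one by (meson less_imp_le)

lemma analytic_near_add [intro]:
  "analytic_near a g \<Longrightarrow> analytic_near a h \<Longrightarrow> analytic_near a (\<lambda>x. g x + h x)"
  by (erule (1) analytic_near_common) (auto simp: analytic_near_def intro: series_bound_add)

lemma analytic_near_mult [intro]:
  "analytic_near a g \<Longrightarrow> analytic_near a h \<Longrightarrow> analytic_near a (\<lambda>x. g x * h x)"
  by (erule (1) analytic_near_common) (auto simp: analytic_near_def intro: series_bound_mult)

lemma analytic_near_uminus [intro]: "analytic_near a g \<Longrightarrow> analytic_near a (\<lambda>x. - g x)"
  using analytic_near_mult[OF analytic_near_const[of a "-1"]] by simp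

lemma analytic_near_diff [intro]:
  "analytic_near a g \<Longrightarrow> analytic_near a h \<Longrightarrow> analytic_near a (\<lambda>x. g x - h x)"
  using analytic_near_add[OF _ analytic_near_uminus] by simp

lemma analytic_near_sum [intro]:
  "(\<And>j. j \<in> J \<Longrightarrow> analytic_near a (g j)) \<Longrightarrow> analytic_near a (\<lambda>x. \<Sum>j\<in>J. g j x)"
  by (induction J rule: infinite_finite_induct) auto

lemma analytic_near_coord [intro]: "analytic_near a (\<lambda>x. of_real (x $ i))"
proof -
  have "analytic_near a (\<lambda>x. of_real (x $ i - a $ i))"
    unfolding analytic_near_def using series_bound_coord[of 1 a i] zero_less_one by (meson less_imp_le)
  from analytic_near_add[OF this analytic_near_const[of a "of_real (a $ i)"]] show ?thesis by simp
qed

text \<open>The Taylor series of \<open>\<phi>\<close> at \<open>g a\<close> is evaluated in powers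
  of \<open>g x - g a\<close>. This difference vanishes at \<open>a\<close>, so on a small cube its
  norm bound \<open>q\<close> is below the radius of the Taylor disc and the bounds
  \<open>norm (d n) * q ^ n\<close> are summable.\<close>

lemma analytic_near_compose:
  assumes g: "analytic_near a g" and \<phi>: "\<phi> holomorphic_on U" "open U" "g a \<in> U"
  shows "analytic_near a (\<lambda>x. \<phi> (g x))"
proof -
  obtain \<rho> where \<rho>: "\<rho> > 0" "ball (g a) \<rho> \<subseteq> U" using \<phi>(2,3) openE by blast
  define d where "d = (\<lambda>n. (deriv ^^ n) \<phi> (g a) / fact n)"
  have ser: "(\<lambda>n. d n * (w - g a) ^ n) sums \<phi> w" if "w \<in> ball (g a) \<rho>" for w
    unfolding d_def using holomorphic_power_series[OF holomorphic_on_subset[OF \<phi>(1) \<rho>(2)] that] .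
  have "analytic_near a (\<lambda>x. g x - g a)" using g by auto
  then obtain r M where r: "r > 0" and M: "series_bound a r M (\<lambda>x. g x - g a)"
    unfolding analytic_near_def by blast
  have M0: "M \<ge> 0" using series_bound_nonneg[OF M] r by simp
  \<comment> \<open>This scale gives \<open>t * M \<le> \<rho> / 2\<close>; the summand 1 keeps the
    denominator positive when \<open>M = 0\<close>.\<close>
  define t where "t = min 1 (\<rho> / (2 * (M + 1)))"
  have t: "0 < t" "t \<le> 1" using \<rho> M0 by (auto simp: t_def)
  have "t * M \<le> \<rho> / (2 * (M + 1)) * M"
    using M0 by (intro mult_right_mono) (auto simp: t_def)
  also have "\<dots> \<le> \<rho> / 2" using M0 \<rho> by (simp add: field_simps)
  finally have "t * M < \<rho>" "0 \<le> t * M" using \<rho> t M0 by auto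
  moreover define q where "q = t * M"
  ultimately have q: "q < \<rho>" "0 \<le> q" by simp_all
  have *: "series_bound a (t * r) q (\<lambda>x. g x - g a)"
    using series_bound_scale[OF M] r t by (auto simp: q_def)
  have tr: "t * r > 0" using t r by simp
  \<comment> \<open>The midpoint of \<open>q\<close> and \<open>\<rho>\<close> still lies in the
    disc; convergence there yields absolute convergence at \<open>q\<close>.\<close>
  have "summable (\<lambda>n. norm (d n * (of_real q) ^ n))"
  proof (rule powser_insidea[where x = "of_real ((q + \<rho>) / 2)"])
    have "g a + of_real ((q + \<rho>) / 2) \<in> ball (g a) \<rho>"
      using q \<rho> by (auto simp: dist_norm simp del: of_real_divide of_real_add)
    from sums_summable[OF ser[OF this]]
    show "summable (\<lambda>n. d n * of_real ((q + \<rho>) / 2) ^ n)" by simp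
    show "norm (complex_of_real q) < norm (complex_of_real ((q + \<rho>) / 2))"
      using q \<rho> by (simp del: of_real_divide of_real_add of_real_mult)
  qed
  then have sm: "summable (\<lambda>n. norm (d n) * q ^ n)"
    using q by (simp add: norm_mult norm_power del: of_real_mult)
  have "series_bound a (t * r) (\<Sum>n. norm (d n) * q ^ n) (\<lambda>x. \<phi> (g x))"
  proof (rule series_bound_sums[OF tr _ sm])
    show "series_bound a (t * r) (norm (d n) * q ^ n) (\<lambda>x. d n * (g x - g a) ^ n)" for n
      by (intro series_bound_cmult series_bound_power tr *)
    fix x assume "x \<in> cube a (t * r)"
    from series_bound_norm_le[OF * this] show "(\<lambda>n. d n * (g x - g a) ^ n) sums \<phi> (g x)"
      using q by (intro ser) (simp add: dist_norm norm_minus_commute)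
  qed
  then show ?thesis unfolding analytic_near_def using tr by blast
qed

text \<open>The monomials take real values, so the real parts of the coefficients represent the real
  part of the function, with no larger norm.\<close>

lemma analytic_near_Re:
  assumes "analytic_near a g"
  shows "analytic_near a (\<lambda>x. of_real (Re (g x)))"
proof -
  obtain r M c S where r: "r > 0" "S \<le> M" and c: "((\<lambda>\<alpha>. norm (c \<alpha>) * r ^ mdeg \<alpha>) has_sum S) UNIV"
    "\<And>x. x \<in> cube a r \<Longrightarrow> ((\<lambda>\<alpha>. monom_at a x \<alpha> *\<^sub>R c \<alpha>) has_sum g x) UNIV"
    using assms unfolding analytic_near_def series_bound_def by metis
  have le: "norm (complex_of_real (Re (c \<alpha>))) * r ^ mdeg \<alpha> \<le> norm (c \<alpha>) * r ^ mdeg \<alpha>" for \<alpha>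
    using r abs_Re_le_cmod[of "c \<alpha>"] by (intro mult_right_mono) auto
  have "(\<lambda>\<alpha>. norm (complex_of_real (Re (c \<alpha>))) * r ^ mdeg \<alpha>) summable_on UNIV"
    by (rule summable_on_comparison_test[OF has_sum_imp_summable[OF c(1)]]) (use le r in auto)
  then obtain T where T: "((\<lambda>\<alpha>. norm (complex_of_real (Re (c \<alpha>))) * r ^ mdeg \<alpha>) has_sum T) UNIV"
    using summable_iff_has_sum_infsum by blast
  have "((\<lambda>\<alpha>. monom_at a x \<alpha> *\<^sub>R complex_of_real (Re (c \<alpha>))) has_sum complex_of_real (Re (g x))) UNIV" if "x \<in> cube a r" for x
    using has_sum_of_real[OF has_sum_Re[OF c(2)[OF that]]] by (simp add: scaleR_conv_of_real)
  then show ?thesis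
    unfolding analytic_near_def series_bound_def using r(1) T by (meson order_refl)
qed

lemma analytic_near_Im:
  assumes "analytic_near a g"
  shows "analytic_near a (\<lambda>x. of_real (Im (g x)))"
  using analytic_near_Re[OF analytic_near_mult[OF analytic_near_const[of a "- \<i>"] assms]] by simp

lemma ball_subset_cube: "ball a r \<subseteq> cube a r"
proof
  fix x assume "x \<in> ball a r"
  then have "norm (x - a) < r" by (simp add: dist_norm norm_minus_commute)
  then show "x \<in> cube a r"
    using component_le_norm_cart[of "x - a"] unfolding cube_def by (auto intro: order_trans less_imp_le)
qed

text \<open>A real component may come with a complex series: the real parts of the coefficients
  represent it too. The least of the finitely many radii serves all components at once.\<close>

lemma real_analytic_onI:
  fixes f :: "real ^ 'n \<Rightarrow> real ^ 'm"
  assumes S: "open S"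
    and f: "\<And>a i. a \<in> S \<Longrightarrow> \<exists>g. analytic_near a g \<and> (\<forall>\<^sub>F x in nhds a. g x = of_real (f x $ i))"
  shows "f real_analytic_on S"
  unfolding real_analytic_on_def
proof
  fix a assume a: "a \<in> S"
  have "\<exists>\<rho> c. \<rho> > 0 \<and> (\<forall>x\<in>ball a \<rho>. ((\<lambda>\<alpha>. monom_at a x \<alpha> *\<^sub>R c \<alpha>) has_sum f x $ i) UNIV)" for i
  proof -
    obtain g where g: "analytic_near a g" "\<forall>\<^sub>F x in nhds a. g x = of_real (f x $ i)"
      using f[OF a] by blast
    obtain r M c where r: "r > 0" and c: "\<And>x. x \<in> cube a r \<Longrightarrow> ((\<lambda>\<alpha>. monom_at a x \<alpha> *\<^sub>R c \<alpha>) has_sum g x) UNIV"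
      using g(1) unfolding analytic_near_def series_bound_def by metis
    obtain s where s: "s > 0" "\<And>x. dist x a < s \<Longrightarrow> g x = of_real (f x $ i)"
      using g(2) unfolding eventually_nhds_metric by blast
    have "((\<lambda>\<alpha>. monom_at a x \<alpha> *\<^sub>R Re (c \<alpha>)) has_sum f x $ i) UNIV" if "x \<in> ball a (min r s)" for x
      using has_sum_Re[OF c[of x]] that ball_subset_cube[of a r] s(2)[of x] by (auto simp: dist_commute)
    then show ?thesis
      using r s(1) by (intro exI[of _ "min r s"] exI[of _ "\<lambda>\<alpha>. Re (c \<alpha>)"]) auto
  qed
  then obtain \<rho> c where \<rho>: "\<And>i. \<rho> i > 0"
    and c: "\<And>i x. x \<in> ball a (\<rho> i) \<Longrightarrow> ((\<lambda>\<alpha>. monom_at a x \<alpha> *\<^sub>R c i \<alpha>) has_sum f x $ i) UNIV"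
    by metis
  obtain \<sigma> where \<sigma>: "\<sigma> > 0" "ball a \<sigma> \<subseteq> S" using S a openE by blast
  define r where "r = min \<sigma> (Min (range \<rho>))"
  have r: "r > 0" "\<And>i. r \<le> \<rho> i" "r \<le> \<sigma>"
    using \<rho> \<sigma> by (auto simp: r_def min_le_iff_disj)
  have "((\<lambda>\<alpha>. monom_at a x \<alpha> *\<^sub>R (\<chi> i. c i \<alpha>)) has_sum f x) UNIV" if x: "x \<in> ball a r" for x
    unfolding has_sum_def
  proof (rule vec_tendstoI)
    fix i
    have "x \<in> ball a (\<rho> i)" using x r(2)[of i] by auto
    from c[OF this] show "((\<lambda>F. (\<Sum>\<alpha>\<in>F. monom_at a x \<alpha> *\<^sub>R (\<chi> i. c i \<alpha>)) $ i) \<longlongrightarrow> f x $ i) (finite_subsets_at_top UNIV)"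
      by (simp add: has_sum_def)
  qed
  then show "\<exists>r>0. \<exists>c. ball a r \<subseteq> S \<and> (\<forall>x\<in>ball a r. ((\<lambda>\<alpha>. (\<Prod>i\<in>UNIV. (x $ i - a $ i) ^ \<alpha> i) *\<^sub>R c \<alpha>) has_sum f x) UNIV)"
    using r \<sigma>(2) unfolding monom_at_def
    by (intro exI[of _ r] exI[of _ "\<lambda>\<alpha>. \<chi> i. c i \<alpha>"] conjI ballI) auto
qed

section \<open>The axial first-order system in the plane\<close>

text \<open>The Poincare lemma on a convex set: the potential is the integral of the form along the
  segment from \<open>z0\<close> to \<open>z\<close>, differentiated under the integral
  sign.\<close>

lemma closed_form_has_potential:
  fixes p q :: "complex \<Rightarrow> real"
  assumes D: "open D" "convex D"
    and p: "\<And>z. z \<in> D \<Longrightarrow> (p has_derivative (\<lambda>h. p1 z * Re h + p2 z * Im h)) (at z)"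
    and q: "\<And>z. z \<in> D \<Longrightarrow> (q has_derivative (\<lambda>h. q1 z * Re h + q2 z * Im h)) (at z)"
    and cont: "continuous_on D p1" "continuous_on D p2" "continuous_on D q1" "continuous_on D q2"
    and closed: "\<And>z. z \<in> D \<Longrightarrow> p2 z = q1 z"
  obtains K where "\<And>z. z \<in> D \<Longrightarrow> (K has_derivative (\<lambda>h. p z * Re h + q z * Im h)) (at z)"
proof (cases "D = {}")
  case False
  then obtain z0 where z0: "z0 \<in> D" by blast
  define P where "P = (\<lambda>z t. z0 + of_real t * (z - z0))"
  define f where "f = (\<lambda>z t. p (P z t) * Re (z - z0) + q (P z t) * Im (z - z0))"
  \<comment> \<open>The coordinate forms \<open>da\<close> and \<open>db\<close> as bounded
    functionals, since \<open>leibniz_rule\<close> works with blinfun-valued derivatives.\<close>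
  define bR bI where "bR = blinfun_inner_right (1::complex)" and "bI = blinfun_inner_right \<i>"
  have b [simp]: "blinfun_apply bR h = Re h" "blinfun_apply bI h = Im h" for h
    by (simp_all add: bR_def bI_def blinfun_inner_right.rep_eq inner_complex_def)
  define fx where "fx = (\<lambda>z t.
      (p (P z t) + t * (p1 (P z t) * Re (z - z0) + q1 (P z t) * Im (z - z0))) *\<^sub>R bR
    + (q (P z t) + t * (p2 (P z t) * Re (z - z0) + q2 (P z t) * Im (z - z0))) *\<^sub>R bI)"
  have fx: "blinfun_apply (fx z t) h =
      (p (P z t) + t * (p1 (P z t) * Re (z - z0) + q1 (P z t) * Im (z - z0))) * Re h
    + (q (P z t) + t * (p2 (P z t) * Re (z - z0) + q2 (P z t) * Im (z - z0))) * Im h" for z t h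
    by (simp add: fx_def blinfun.add_left blinfun.scaleR_left)
  have PD: "P z t \<in> D" if "z \<in> D" "t \<in> {0..1}" for z t
  proof -
    have "P z t = (1 - t) *\<^sub>R z0 + t *\<^sub>R z"
      by (simp add: P_def scaleR_conv_of_real algebra_simps)
    then show ?thesis using convexD_alt[OF D(2) z0 that(1)] that(2) by simp
  qed
  have contP: "continuous_on X (\<lambda>x. P (fst x) (snd x))" for X
    unfolding P_def by (intro continuous_intros)
  have cpq: "continuous_on D p" "continuous_on D q"
    using p q by (meson has_derivative_continuous continuous_at_imp_continuous_on)+
  have cc: "continuous_on (D \<times> {0..1}) (\<lambda>x. g (P (fst x) (snd x)))" if "continuous_on D g" for g :: "complex \<Rightarrow> real"
    by (rule continuous_on_compose2[OF that contP]) (auto intro: PD)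
  have cc1: "continuous_on {0..1} (\<lambda>t. g (P z t))" if "continuous_on D g" "z \<in> D" for z and g :: "complex \<Rightarrow> real"
    by (rule continuous_on_compose2[OF that(1), of _ "P z"]) (use PD that(2) in \<open>auto simp: P_def intro!: continuous_intros\<close>)
  have dz: "((\<lambda>z. f z t) has_derivative blinfun_apply (fx z t)) (at z within D)" if "z \<in> D" "t \<in> cbox 0 1" for z t
  proof -
    have Pz: "((\<lambda>z. P z t) has_derivative (\<lambda>h. of_real t * h)) (at z)"
      unfolding P_def by (auto intro!: derivative_eq_intros)
    have "P z t \<in> D" using PD that by simp
    note pP = has_derivative_compose[OF Pz p[OF this]] has_derivative_compose[OF Pz q[OF this]]
    have "((\<lambda>z. f z t) has_derivative blinfun_apply (fx z t)) (at z)"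
      unfolding f_def
      by (rule derivative_eq_intros pP refl has_derivative_Re has_derivative_Im)+
         (simp add: fun_eq_iff fx algebra_simps)
    then show ?thesis by (rule has_derivative_at_withinI)
  qed
  have int: "f z integrable_on cbox 0 1" if "z \<in> D" for z
    unfolding f_def by (rule integrable_continuous) (use cc1[OF _ that] cpq in \<open>auto intro!: continuous_intros\<close>)
  have cfx: "continuous_on (D \<times> cbox 0 1) (\<lambda>(z, t). fx z t)"
    unfolding fx_def case_prod_unfold box_real
    by (intro continuous_intros cc cont cpq)
  have val: "(fx z has_integral (p z *\<^sub>R bR + q z *\<^sub>R bI)) {0..1}" if z: "z \<in> D" for z
  proof -
    \<comment> \<open>The differentiated integrand is the \<open>t\<close>-derivative of
      \<open>t (p da + q db)\<close> along the segment; this is where \<open>p2 = q1\<close>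
      enters.\<close>
    let ?F = "\<lambda>t. (t * p (P z t)) *\<^sub>R bR + (t * q (P z t)) *\<^sub>R bI"
    have "(fx z has_integral (?F 1 - ?F 0)) {0..1}"
    proof (rule fundamental_theorem_of_calculus)
      fix t :: real assume t: "t \<in> {0..1}"
      have Pt: "((\<lambda>t. P z t) has_derivative (\<lambda>h. of_real h * (z - z0))) (at t)"
        unfolding P_def by (auto intro!: derivative_eq_intros)
      have PtD: "P z t \<in> D" using PD z t by simp
      note pP = has_derivative_compose[OF Pt p[OF PtD]] has_derivative_compose[OF Pt q[OF PtD]]
      have "(?F has_derivative (\<lambda>h. h *\<^sub>R fx z t)) (at t)"
        by (rule derivative_eq_intros pP refl)+
           (simp add: fun_eq_iff fx_def closed[OF PtD] algebra_simps)
      then show "(?F has_vector_derivative fx z t) (at t within {0..1})"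
        unfolding has_vector_derivative_def by (rule has_derivative_at_withinI)
    qed simp
    then show ?thesis by (simp add: P_def)
  qed
  have "((\<lambda>z. integral (cbox 0 1) (f z)) has_derivative (\<lambda>h. p z * Re h + q z * Im h)) (at z)" if "z \<in> D" for z
  proof -
    have "((\<lambda>z. integral (cbox 0 1) (f z)) has_derivative blinfun_apply (integral (cbox 0 1) (fx z))) (at z within D)"
      by (rule leibniz_rule[OF dz int cfx that D(2)])
    moreover have "blinfun_apply (integral (cbox 0 1) (fx z)) = (\<lambda>h. p z * Re h + q z * Im h)"
      using integral_unique[OF val[OF that]] by (simp add: fun_eq_iff blinfun.add_left blinfun.scaleR_left)
    ultimately show ?thesis using at_within_open[OF that D(1)] by simp
  qed
  then show thesis by (rule that)
qed simp

text \<open>Given the differential of \<open>K\<close>, the two equations for \<open>u\<close> and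
  \<open>v\<close> are precisely the Cauchy-Riemann equations of \<open>\<Psi>\<close>. No
  conclusion divides by \<open>Im z\<close>, so \<open>D\<close> may meet the real axis.\<close>

lemma axial_system_holomorphic:
  fixes u v :: "complex \<Rightarrow> real"
  assumes D: "open D" "convex D"
    and u: "\<And>z. z \<in> D \<Longrightarrow> (u has_derivative (\<lambda>h. u1 z * Re h + u2 z * Im h)) (at z)"
    and v: "\<And>z. z \<in> D \<Longrightarrow> (v has_derivative (\<lambda>h. v1 z * Re h + v2 z * Im h)) (at z)"
    and cont: "continuous_on D u1" "continuous_on D u2" "continuous_on D v1" "continuous_on D v2"
    and eq1: "\<And>z. z \<in> D \<Longrightarrow> v1 z = - u2 z"
    and eq2: "\<And>z. z \<in> D \<Longrightarrow> Im z * u1 z = Im z * v2 z + 2 * v z"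
  obtains \<Phi> \<Psi> where "\<Psi> holomorphic_on D" "\<And>z. z \<in> D \<Longrightarrow> (\<Phi> has_field_derivative \<Psi> z) (at z)"
    "\<And>z. z \<in> D \<Longrightarrow> Im z * u z = - Im (\<Psi> z)"
    "\<And>z. z \<in> D \<Longrightarrow> (Im z)\<^sup>2 * v z = Im z * Re (\<Psi> z) - Im (\<Phi> z)"
proof -
  obtain K where K: "\<And>z. z \<in> D \<Longrightarrow> (K has_derivative (\<lambda>h. - u z * Re h + v z * Im h)) (at z)"
  proof (rule closed_form_has_potential[of D "\<lambda>z. - u z" "\<lambda>z. - u1 z" "\<lambda>z. - u2 z" v v1 v2])
    fix z assume "z \<in> D"
    from has_derivative_minus[OF u[OF this]]
    show "((\<lambda>z. - u z) has_derivative (\<lambda>h. - u1 z * Re h + - u2 z * Im h)) (at z)"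
      by simp
  qed (use D v cont eq1 in \<open>auto intro!: continuous_intros\<close>)
  define \<Psi> where "\<Psi> = (\<lambda>z. of_real (K z + Im z * v z) + \<i> * of_real (- Im z * u z))"
  have d\<Psi>: "(\<Psi> has_field_derivative Complex (- u z + Im z * v1 z) (- Im z * u1 z)) (at z)" if z: "z \<in> D" for z
  proof -
    have e1: "v1 z = - u2 z" using eq1 z by simp
    have e2: "x * (Im z * u1 z) = x * (Im z * v2 z) + x * (v z * 2)" for x
      using arg_cong[OF eq2[OF z], of "\<lambda>y. x * y"] by (simp add: algebra_simps)
    have "((\<lambda>z. of_real (K z + Im z * v z) + \<i> * of_real (- Im z * u z)) has_derivative
       (\<lambda>h. Complex (- u z + Im z * v1 z) (- Im z * u1 z) * h)) (at z)"
      by (rule derivative_eq_intros K[OF z] u[OF z] v[OF z] refl has_derivative_Im)+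
         (simp add: fun_eq_iff complex_eq_iff e1 e2 algebra_simps)
    then show ?thesis
      unfolding has_field_derivative_def \<Psi>_def .
  qed
  have hol: "\<Psi> holomorphic_on D"
    using d\<Psi> by (meson D(1) holomorphic_onI field_differentiable_def field_differentiable_at_within)
  obtain F where F: "\<And>z. z \<in> D \<Longrightarrow> (F has_field_derivative \<Psi> z) (at z within D)"
    using holomorphic_convex_primitive'[OF D(2,1) hol] by blast
  have F': "(F has_derivative (\<lambda>h. \<Psi> z * h)) (at z)" if "z \<in> D" for z
    using F[OF that] at_within_open[OF that D(1)] by (simp add: has_field_derivative_def)
  \<comment> \<open>\<open>Im F\<close> and \<open>Im z * K\<close> have the same differential
    \<open>- b u da + (K + b v) db\<close>. Their constant difference is removed by subtracting
    \<open>\<i> * c\<close> from the primitive.\<close>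
  have "\<exists>c. \<forall>z\<in>D. Im (F z) - Im z * K z = c"
  proof (rule has_derivative_zero_constant[OF D(2)])
    fix z assume z: "z \<in> D"
    have "((\<lambda>z. Im (F z) - Im z * K z) has_derivative (\<lambda>h. 0)) (at z)"
      by (rule derivative_eq_intros K[OF z] has_derivative_Im F'[OF z] refl)+
         (simp add: fun_eq_iff \<Psi>_def algebra_simps)
    then show "((\<lambda>z. Im (F z) - Im z * K z) has_derivative (\<lambda>h. 0)) (at z within D)"
      by (rule has_derivative_at_withinI)
  qed
  then obtain c where c: "\<And>z. z \<in> D \<Longrightarrow> Im (F z) - Im z * K z = c" by blast
  show thesis
  proof (rule that[OF hol, of "\<lambda>z. F z - \<i> * of_real c"])
    fix z assume z: "z \<in> D"
    show "((\<lambda>z. F z - \<i> * of_real c) has_field_derivative \<Psi> z) (at z)"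
      using F[OF z] at_within_open[OF z D(1)] by (auto intro!: derivative_eq_intros)
    show "Im z * u z = - Im (\<Psi> z)" by (simp add: \<Psi>_def)
    show "(Im z)\<^sup>2 * v z = Im z * Re (\<Psi> z) - Im (F z - \<i> * of_real c)"
      using c[OF z] by (simp add: \<Psi>_def algebra_simps power2_eq_square)
  qed
qed

section \<open>Octonions and the operator on axial functions\<close>

text \<open>The index one appears as \<open>Suc 0\<close>, its simplified form, so that the cases
  match simplified coordinates.\<close>

lemma oct_index_cases:
  "i \<le> 7 \<Longrightarrow> P 0 \<Longrightarrow> P (Suc 0) \<Longrightarrow> P 2 \<Longrightarrow> P 3 \<Longrightarrow> P 4 \<Longrightarrow> P 5 \<Longrightarrow> P 6 \<Longrightarrow> P 7 \<Longrightarrow> P (i::nat)"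
proof -
  assume *: "i \<le> 7" "P 0" "P (Suc 0)" "P 2" "P 3" "P 4" "P 5" "P 6" "P 7"
  have "i \<in> {0, Suc 0, 2, 3, 4, 5, 6, 7}" using *(1) by auto
  then show "P i" using *(2-) by blast
qed

lemma oct_coord_mult_sum:
  assumes "i \<le> 7"
  shows "oct_coord (x \<odot> y) i = (\<Sum>l=0..7. \<Sum>m=0..7. oct_coord x l * oct_coord y m *
    (if l = 0 then (if m = i then 1 else 0) else if m = 0 then (if l = i then 1 else 0)
     else if l = m then (if i = 0 then -1 else 0) else if i = 0 then 0 else oct_eps l m i))"
  unfolding oct_mult_def oct_coord_simps
  by (intro sum.cong refl) (use assms in \<open>simp add: oct_coord_basis_mult\<close>)

lemma oct_coord_mult:
  "oct_coord (x \<odot> y) 0 = oct_coord x 0 * oct_coord y 0 - oct_coord x (Suc 0) * oct_coord y (Suc 0) - oct_coord x 2 * oct_coord y 2 - oct_coord x 3 * oct_coord y 3 - oct_coord x 4 * oct_coord y 4 - oct_coord x 5 * oct_coord y 5 - oct_coord x 6 * oct_coord y 6 - oct_coord x 7 * oct_coord y 7"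
  "oct_coord (x \<odot> y) (Suc 0) = oct_coord x 0 * oct_coord y (Suc 0) + oct_coord x (Suc 0) * oct_coord y 0 + oct_coord x 2 * oct_coord y 3 - oct_coord x 3 * oct_coord y 2 + oct_coord x 4 * oct_coord y 5 - oct_coord x 5 * oct_coord y 4 - oct_coord x 6 * oct_coord y 7 + oct_coord x 7 * oct_coord y 6"
  "oct_coord (x \<odot> y) 2 = oct_coord x 0 * oct_coord y 2 - oct_coord x (Suc 0) * oct_coord y 3 + oct_coord x 2 * oct_coord y 0 + oct_coord x 3 * oct_coord y (Suc 0) + oct_coord x 4 * oct_coord y 6 + oct_coord x 5 * oct_coord y 7 - oct_coord x 6 * oct_coord y 4 - oct_coord x 7 * oct_coord y 5"
  "oct_coord (x \<odot> y) 3 = oct_coord x 0 * oct_coord y 3 + oct_coord x (Suc 0) * oct_coord y 2 - oct_coord x 2 * oct_coord y (Suc 0) + oct_coord x 3 * oct_coord y 0 + oct_coord x 4 * oct_coord y 7 - oct_coord x 5 * oct_coord y 6 + oct_coord x 6 * oct_coord y 5 - oct_coord x 7 * oct_coord y 4"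
  "oct_coord (x \<odot> y) 4 = oct_coord x 0 * oct_coord y 4 - oct_coord x (Suc 0) * oct_coord y 5 - oct_coord x 2 * oct_coord y 6 - oct_coord x 3 * oct_coord y 7 + oct_coord x 4 * oct_coord y 0 + oct_coord x 5 * oct_coord y (Suc 0) + oct_coord x 6 * oct_coord y 2 + oct_coord x 7 * oct_coord y 3"
  "oct_coord (x \<odot> y) 5 = oct_coord x 0 * oct_coord y 5 + oct_coord x (Suc 0) * oct_coord y 4 - oct_coord x 2 * oct_coord y 7 + oct_coord x 3 * oct_coord y 6 - oct_coord x 4 * oct_coord y (Suc 0) + oct_coord x 5 * oct_coord y 0 - oct_coord x 6 * oct_coord y 3 + oct_coord x 7 * oct_coord y 2"
  "oct_coord (x \<odot> y) 6 = oct_coord x 0 * oct_coord y 6 + oct_coord x (Suc 0) * oct_coord y 7 + oct_coord x 2 * oct_coord y 4 - oct_coord x 3 * oct_coord y 5 - oct_coord x 4 * oct_coord y 2 + oct_coord x 5 * oct_coord y 3 + oct_coord x 6 * oct_coord y 0 - oct_coord x 7 * oct_coord y (Suc 0)"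
  "oct_coord (x \<odot> y) 7 = oct_coord x 0 * oct_coord y 7 - oct_coord x (Suc 0) * oct_coord y 6 + oct_coord x 2 * oct_coord y 5 + oct_coord x 3 * oct_coord y 4 - oct_coord x 4 * oct_coord y 3 - oct_coord x 5 * oct_coord y 2 + oct_coord x 6 * oct_coord y (Suc 0) + oct_coord x 7 * oct_coord y 0"
  by (simp_all add: oct_coord_mult_sum sum_0_7 oct_eps_def oct_triples_def)

lemma bounded_bilinear_oct_mult: "bounded_bilinear (\<odot>)"
proof -
  have "bilinear (\<odot>)"
    unfolding bilinear_def
    by (intro conjI allI linearI)
       (simp_all add: oct_mult_def oct_coord_simps algebra_simps sum.distrib scaleR_sum_right)
  then show ?thesis by (simp add: bilinear_conv_bounded_bilinear)
qed

interpretation oct: bounded_bilinear "(\<odot>)"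
  by (rule bounded_bilinear_oct_mult)

lemma oct_coord_Im: "i \<le> 7 \<Longrightarrow> oct_coord (oct_Im x) i = (if i = 0 then 0 else oct_coord x i)"
  by (erule oct_index_cases) (simp_all only: oct_Im_def sum_1_7, simp_all add: oct_coord_simps oct_coord_oct_e)

lemma oct_Re_Im: "x = oct_Re x *\<^sub>R oct_e 0 + oct_Im x"
  by (rule oct_eqI) (simp add: oct_coord_simps oct_coord_Im oct_Re_def oct_coord_oct_e)

lemma oct_Im_eq: "oct_Im x = x - oct_Re x *\<^sub>R oct_e 0"
  using oct_Re_Im[of x] by (simp add: algebra_simps)

lemma oct_inner: "x \<bullet> y = (\<Sum>l=0..7. oct_coord x l * oct_coord y l)"
proof -
  have "x \<bullet> y = (\<Sum>i\<in>UNIV. x $ i * y $ i)"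
    by (simp add: inner_vec_def)
  also have "\<dots> = (\<Sum>l=0..7. oct_coord x l * oct_coord y l)"
    unfolding UNIV_8 by (subst sum.reindex[OF inj_of_nat_8]) (simp add: oct_coord_def)
  finally show ?thesis .
qed

lemma oct_coord_eq_inner: "oct_coord x l = x \<bullet> oct_e l"
  by (simp add: oct_coord_def oct_e_def inner_axis)

lemma bounded_linear_oct_coord: "bounded_linear (\<lambda>x. oct_coord x l)"
  unfolding oct_coord_def by (rule bounded_linear_vec_nth)

lemma bounded_linear_oct_Im: "bounded_linear oct_Im"
  unfolding oct_Im_def [abs_def]
  by (intro bounded_linear_sum bounded_linear_scaleR_left[THEN bounded_linear_compose] bounded_linear_oct_coord)

text \<open>Left alternativity \<open>a (a v) = (a a) v\<close> for imaginary \<open>a\<close>,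
  checked in coordinates. Together with its polarization it does the work of associativity; in
  particular it makes left multiplication by a nonzero \<open>a\<close> injective.\<close>

lemma oct_imaginary_square_mult:
  assumes "oct_Re a = 0"
  shows "a \<odot> (a \<odot> v) = - ((norm a)\<^sup>2) *\<^sub>R v"
proof -
  have a0: "oct_coord a 0 = 0" using assms by (simp add: oct_Re_def)
  have sq: "(norm a)\<^sup>2 = oct_coord a (Suc 0) * oct_coord a (Suc 0) + oct_coord a 2 * oct_coord a 2 + oct_coord a 3 * oct_coord a 3
      + oct_coord a 4 * oct_coord a 4 + oct_coord a 5 * oct_coord a 5 + oct_coord a 6 * oct_coord a 6 + oct_coord a 7 * oct_coord a 7"
    unfolding norm_oct sum_0_7 a0 by (simp add: power2_eq_square)
  show ?thesis
    unfolding sq by (rule oct_eqI, erule oct_index_cases)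
       (simp_all add: oct_coord_simps oct_coord_mult a0 algebra_simps)
qed

text \<open>Polarization: the square identity is applied to \<open>a + b\<close>.\<close>

lemma oct_imaginary_anticommute:
  assumes a: "oct_Re a = 0" and b: "oct_Re b = 0"
  shows "a \<odot> (b \<odot> v) + b \<odot> (a \<odot> v) = (- 2 * (a \<bullet> b)) *\<^sub>R v"
proof -
  have "oct_Re (a + b) = 0" using a b by (simp add: oct_Re_def oct_coord_simps)
  from oct_imaginary_square_mult[OF this, of v]
  have "a \<odot> (a \<odot> v) + b \<odot> (b \<odot> v) + (a \<odot> (b \<odot> v) + b \<odot> (a \<odot> v)) = - ((norm (a + b))\<^sup>2) *\<^sub>R v"
    by (simp add: oct.add_left oct.add_right algebra_simps)
  then show ?thesis
    unfolding oct_imaginary_square_mult[OF a] oct_imaginary_square_mult[OF b]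
    by (simp add: power2_norm_eq_inner inner_add_left inner_add_right inner_commute algebra_simps)
       (simp add: eq_neg_iff_add_eq_0 add.assoc)
qed

lemma oct_imaginary_cancel:
  assumes "oct_Re a = 0" "a \<noteq> 0" "a \<odot> v = 0"
  shows "v = 0"
  using oct_imaginary_square_mult[OF assms(1), of v] assms by (simp add: oct.zero_right)

lemma oct_inverse_imaginary: "oct_Re a = 0 \<Longrightarrow> oct_inverse a = - (1 / (norm a)\<^sup>2) *\<^sub>R a"
  using oct_Re_Im[of a] by (simp add: oct_inverse_def oct_cnj_def)

lemma oct_Re_e: "1 \<le> l \<Longrightarrow> l \<le> 7 \<Longrightarrow> oct_Re (oct_e l) = 0"
  by (simp add: oct_Re_def oct_coord_oct_e)

lemma norm_oct_e: "norm (oct_e l) = 1"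
  by (simp add: oct_e_def norm_axis_1)

text \<open>One summand of \<open>\<Gamma>\<close> on the field \<open>x \<mapsto> (Im x) v\<close>.
  Orthogonal units are exchanged by anticommutation, and a unit applied twice is \<open>-1\<close>,
  which leaves only single products with \<open>v\<close>.\<close>

lemma oct_e_mult_mult_e:
  assumes "m \<in> {1..7}" "n \<in> {1..7}" "m \<noteq> n"
  shows "oct_e m \<odot> (oct_e n \<odot> ((s *\<^sub>R oct_e n - t *\<^sub>R oct_e m) \<odot> v)) = - ((s *\<^sub>R oct_e m + t *\<^sub>R oct_e n) \<odot> v)"
proof -
  have R: "oct_Re (oct_e m) = 0" "oct_Re (oct_e n) = 0" using assms by (auto intro: oct_Re_e)
  have sq: "oct_e m \<odot> (oct_e m \<odot> w) = - w" "oct_e n \<odot> (oct_e n \<odot> w) = - w" for w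
    using oct_imaginary_square_mult[OF R(1), of w] oct_imaginary_square_mult[OF R(2), of w] by (simp_all add: norm_oct_e)
  have "oct_e m \<bullet> oct_e n = 0"
    using assms by (simp add: oct_coord_eq_inner[symmetric] oct_coord_oct_e)
  then have "oct_e n \<odot> (oct_e m \<odot> v) = - (oct_e m \<odot> (oct_e n \<odot> v))"
    using oct_imaginary_anticommute[OF R, of v] by (simp add: eq_neg_iff_add_eq_0 add.commute)
  then show ?thesis
    by (simp add: oct.diff_left oct.diff_right oct.add_left oct.scaleR_left oct.scaleR_right oct.minus_right sq algebra_simps)
qed

text \<open>Each of the seven indices lies in six of the 21 pairs.\<close>

lemma sum_pairs_1_7:
  fixes w :: "nat \<Rightarrow> 'a::real_vector"
  shows "(\<Sum>m=1..7. \<Sum>n=m+1..7. w m + w n) = 6 *\<^sub>R (\<Sum>m=1..7. w m)"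
proof -
  have six: "6 *\<^sub>R x = x + x + x + x + x + x" for x :: 'a
  proof -
    have "6 *\<^sub>R x = (1 + 1 + 1 + 1 + 1 + 1) *\<^sub>R x" by simp
    then show ?thesis by (simp only: scaleR_add_left scaleR_one)
  qed
  show ?thesis
    unfolding sum_1_7 six by (simp add: numeral_eq_Suc algebra_simps)
qed

lemma Gamma_sum:
  "(\<Sum>m=1..7. \<Sum>n=m+1..7. oct_e m \<odot> (oct_e n \<odot> ((oct_coord x m *\<^sub>R oct_e n - oct_coord x n *\<^sub>R oct_e m) \<odot> v)))
   = - 6 *\<^sub>R (oct_Im x \<odot> v)"
proof -
  have "(\<Sum>m=1..7. \<Sum>n=m+1..7. oct_e m \<odot> (oct_e n \<odot> ((oct_coord x m *\<^sub>R oct_e n - oct_coord x n *\<^sub>R oct_e m) \<odot> v)))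
      = (\<Sum>m=1..7. \<Sum>n=m+1..7. - ((oct_coord x m *\<^sub>R oct_e m + oct_coord x n *\<^sub>R oct_e n) \<odot> v))"
    by (intro sum.cong refl oct_e_mult_mult_e) auto
  also have "\<dots> = - (\<Sum>m=1..7. \<Sum>n=m+1..7. (oct_coord x m *\<^sub>R oct_e m) \<odot> v + (oct_coord x n *\<^sub>R oct_e n) \<odot> v)"
    by (simp only: sum_negf oct.add_left)
  also have "\<dots> = - 6 *\<^sub>R (oct_Im x \<odot> v)"
    unfolding sum_pairs_1_7 by (simp add: oct_Im_def oct.sum_left)
  finally show ?thesis .
qed

section \<open>Axial functions: reduction to the variables \<open>Re x\<close> and
  \<open>|Im x|\<close>\<close>

definition half_plane :: "octonion \<Rightarrow> complex" where
  "half_plane x = Complex (oct_Re x) (norm (oct_Im x))"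

lemma half_plane_simps [simp]:
  "Re (half_plane x) = oct_Re x" "Im (half_plane x) = norm (oct_Im x)"
  by (simp_all add: half_plane_def)

lemma inner_oct_Im: "oct_Im x \<bullet> oct_Im y = oct_Im x \<bullet> y"
  unfolding oct_inner by (intro sum.cong refl) (simp add: oct_coord_Im)

text \<open>The gradient of \<open>|Im x|\<close> is the unit vector
  \<open>Im x / |Im x|\<close>.\<close>

lemma has_derivative_half_plane:
  assumes "oct_Im x \<noteq> 0"
  shows "(half_plane has_derivative (\<lambda>h. Complex (oct_Re h) (oct_Im x \<bullet> h / norm (oct_Im x)))) (at x)"
proof -
  have 1: "(oct_Re has_derivative oct_Re) (at x)"
    unfolding oct_Re_def [abs_def] by (intro bounded_linear_imp_has_derivative bounded_linear_oct_coord)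
  have 2: "((\<lambda>x. norm (oct_Im x)) has_derivative (\<lambda>h. sgn (oct_Im x) \<bullet> oct_Im h)) (at x)"
    using has_derivative_compose[OF bounded_linear_imp_has_derivative[OF bounded_linear_oct_Im] has_derivative_norm[OF assms]]
    by (simp add: inner_commute)
  have "((\<lambda>x. of_real (oct_Re x) + \<i> * of_real (norm (oct_Im x))) has_derivative
     (\<lambda>h. of_real (oct_Re h) + \<i> * of_real (sgn (oct_Im x) \<bullet> oct_Im h))) (at x)"
    by (auto intro!: derivative_eq_intros 1 2)
  moreover have "Complex p q = of_real p + \<i> * of_real q" for p q
    by (simp add: complex_eq_iff)
  ultimately show ?thesis
    by (simp add: half_plane_def [abs_def] sgn_div_norm inner_oct_Im divide_inverse_commute)
qed

text \<open>In a direction \<open>e_l\<close> with \<open>l \<ge> 1\<close> the derivative splits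
  into a radial part \<open>x_l w\<close> and a tangential part \<open>(1 / b) e_l v\<close>. The
  radial parts cancel in \<open>L_mn\<close>, so \<open>\<Gamma>\<close> sees only \<open>v\<close>;
  in \<open>E\<close> the tangential parts add up to \<open>(1 / b) (Im x) v\<close> and cancel the
  last term of \<open>b\<^sup>2 w\<close>.\<close>

lemma dbar_F_axial:
  fixes u v :: "complex \<Rightarrow> octonion"
  assumes x: "oct_Im x \<noteq> 0"
    and u: "(u has_derivative (\<lambda>h. Re h *\<^sub>R u1 + Im h *\<^sub>R u2)) (at (half_plane x))"
    and v: "(v has_derivative (\<lambda>h. Re h *\<^sub>R v1 + Im h *\<^sub>R v2)) (at (half_plane x))"
    and f: "\<forall>\<^sub>F y in nhds x. f y = u (half_plane y) + (1 / norm (oct_Im y)) *\<^sub>R (oct_Im y \<odot> v (half_plane y))"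
  shows "dbar_F f x = u1 - v2 - (2 / norm (oct_Im x)) *\<^sub>R v (half_plane x)
     + (1 / norm (oct_Im x)) *\<^sub>R (oct_Im x \<odot> (v1 + u2))"
proof -
  define b where "b = norm (oct_Im x)"
  have b: "b > 0" using x by (simp add: b_def)
  define z where "z = half_plane x"
  define J where "J = oct_Im x"
  define s where "s = (\<lambda>h. J \<bullet> h / b)"
  define F' where "F' = (\<lambda>h. oct_Re h *\<^sub>R u1 + s h *\<^sub>R u2 +
     ((1 / b) *\<^sub>R (J \<odot> (oct_Re h *\<^sub>R v1 + s h *\<^sub>R v2) + oct_Im h \<odot> v z) - (s h / b\<^sup>2) *\<^sub>R (J \<odot> v z)))"
  have dz: "(half_plane has_derivative (\<lambda>h. Complex (oct_Re h) (s h))) (at x)"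
    using has_derivative_half_plane[OF x] by (simp add: s_def J_def b_def)
  have nI: "((\<lambda>x. norm (oct_Im x)) has_derivative s) (at x)"
    using has_derivative_Im[OF dz] by simp
  have inv: "((\<lambda>x. 1 / norm (oct_Im x)) has_derivative (\<lambda>h. - (s h / b\<^sup>2))) (at x)"
    using b by (auto intro!: derivative_eq_intros nI simp: b_def[symmetric] power2_eq_square)
  have dI: "(oct_Im has_derivative oct_Im) (at x)"
    by (intro bounded_linear_imp_has_derivative bounded_linear_oct_Im)
  have "((\<lambda>y. u (half_plane y) + (1 / norm (oct_Im y)) *\<^sub>R (oct_Im y \<odot> v (half_plane y))) has_derivative F') (at x)"
    by (rule derivative_eq_intros has_derivative_compose[OF dz u] has_derivative_compose[OF dz v] inv dI oct.FDERIV refl)+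
       (simp add: fun_eq_iff F'_def b_def J_def z_def)
  then have df: "(f has_derivative F') (at x)"
  proof (rule has_derivative_transform_eventually)
    show "\<forall>\<^sub>F y in at x. u (half_plane y) + (1 / norm (oct_Im y)) *\<^sub>R (oct_Im y \<odot> v (half_plane y)) = f y"
      using f by (simp add: eventually_at_filter) (auto elim: eventually_mono)
    show "u (half_plane x) + (1 / norm (oct_Im x)) *\<^sub>R (oct_Im x \<odot> v (half_plane x)) = f x"
      using eventually_nhds_x_imp_x[OF f] by simp
  qed simp
  have partial: "oct_partial l f x = F' (oct_e l)" for l
  proof -
    have "((\<lambda>t. x + t *\<^sub>R oct_e l) has_derivative (\<lambda>t. t *\<^sub>R oct_e l)) (at 0)"
      by (auto intro!: derivative_eq_intros)
    from has_derivative_compose[OF this, of f F'] df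
    have "((\<lambda>t. f (x + t *\<^sub>R oct_e l)) has_derivative (\<lambda>t. F' (t *\<^sub>R oct_e l))) (at 0)" by simp
    then have "((\<lambda>t. f (x + t *\<^sub>R oct_e l)) has_vector_derivative F' (oct_e l)) (at 0)"
      using linear_scale[OF has_derivative_linear[OF df]] by (simp add: has_vector_derivative_def)
    then show ?thesis unfolding oct_partial_def by (rule vector_derivative_at)
  qed
  \<comment> \<open>The common radial factor: the \<open>b\<close>-derivatives of \<open>u\<close>
    and \<open>v\<close>, and the derivative of \<open>1 / |Im y|\<close>, which contributes the
    term with \<open>b ^ 3\<close>.\<close>
  define w where "w = (1 / b) *\<^sub>R u2 + (1 / b\<^sup>2) *\<^sub>R (J \<odot> v2) - (1 / b ^ 3) *\<^sub>R (J \<odot> v z)"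
  have Je: "J \<bullet> oct_e l = (if l = 0 then 0 else oct_coord x l)" if "l \<le> 7" for l
    using oct_coord_Im[OF that, of x] by (simp add: J_def oct_coord_eq_inner)
  have Ie: "oct_Im (oct_e l) = (if l = 0 then 0 else oct_e l)" if "l \<le> 7" for l
    by (rule oct_eqI) (use that in \<open>auto simp: oct_coord_Im oct_coord_oct_e oct_coord_simps\<close>)
  have Re: "oct_Re (oct_e l) = (if l = 0 then 1 else 0)" if "l \<le> 7" for l
    using that by (simp add: oct_Re_def oct_coord_oct_e)
  have p0: "oct_partial 0 f x = u1 + (1 / b) *\<^sub>R (J \<odot> v1)"
    by (simp add: partial F'_def s_def Je Ie Re oct.zero_left oct.zero_right)
  have pl: "oct_partial l f x = oct_coord x l *\<^sub>R w + (1 / b) *\<^sub>R (oct_e l \<odot> v z)" if "l \<in> {1..7}" for l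
    using that b by (simp add: partial F'_def s_def Je Ie Re w_def oct.zero_left oct.scaleR_right
        scaleR_add_right scaleR_diff_right power2_eq_square power3_eq_cube)
  have b2: "(\<Sum>l=1..7. oct_coord x l * oct_coord x l) = b\<^sup>2"
    unfolding b_def norm_oct sum_0_7 sum_1_7 by (simp add: oct_coord_Im power2_eq_square)
  have JJ: "J \<odot> (J \<odot> y) = - (b\<^sup>2) *\<^sub>R y" for y
    using oct_imaginary_square_mult[of J y] by (simp add: J_def b_def oct_Re_def oct_coord_Im)
  have "E_op f x = (\<Sum>l=1..7. (oct_coord x l * oct_coord x l) *\<^sub>R w + (1 / b) *\<^sub>R ((oct_coord x l *\<^sub>R oct_e l) \<odot> v z))"
    unfolding E_op_def by (intro sum.cong refl) (simp add: pl oct.scaleR_left scaleR_add_right mult.commute)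
  also have "\<dots> = b\<^sup>2 *\<^sub>R w + (1 / b) *\<^sub>R (J \<odot> v z)"
    by (simp only: sum.distrib scaleR_left.sum[symmetric] scaleR_right.sum[symmetric] b2 oct.sum_left[symmetric] J_def oct_Im_def)
  also have "\<dots> = b *\<^sub>R u2 + J \<odot> v2"
    using b by (simp add: w_def scaleR_add_right scaleR_diff_right power2_eq_square power3_eq_cube)
  finally have E: "E_op f x = b *\<^sub>R u2 + J \<odot> v2" .
  \<comment> \<open>Both partial derivatives contain \<open>w\<close>, each time with the factor
    \<open>x_m x_n\<close> in the end, and the antisymmetric combination removes it.\<close>
  have L: "L_op m n f x = (1 / b) *\<^sub>R ((oct_coord x m *\<^sub>R oct_e n - oct_coord x n *\<^sub>R oct_e m) \<odot> v z)"
    if "m \<in> {1..7}" "n \<in> {1..7}" for m n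
    unfolding L_op_def pl[OF that(1)] pl[OF that(2)]
    by (simp add: oct.diff_left oct.scaleR_left scaleR_diff_right scaleR_add_right mult.commute)
  have "Gamma_op f x = - (\<Sum>m=1..7. \<Sum>n=m+1..7. (1 / b) *\<^sub>R (oct_e m \<odot> (oct_e n \<odot> ((oct_coord x m *\<^sub>R oct_e n - oct_coord x n *\<^sub>R oct_e m) \<odot> v z))))"
    unfolding Gamma_op_def by (intro arg_cong[of _ _ uminus] sum.cong refl) (simp add: L oct.scaleR_right)
  also have "\<dots> = (6 / b) *\<^sub>R (J \<odot> v z)"
    by (simp only: scaleR_right.sum[symmetric] Gamma_sum) (simp add: J_def)
  finally have G: "Gamma_op f x = (6 / b) *\<^sub>R (J \<odot> v z)" .
  have inv': "oct_inverse (oct_Im x) = - (1 / b\<^sup>2) *\<^sub>R J"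
    using oct_inverse_imaginary[of J] by (simp add: J_def b_def oct_Re_def oct_coord_Im)
  show ?thesis
    unfolding dbar_F_def inv' E G p0 unfolding z_def[symmetric] b_def[symmetric] unfolding J_def[symmetric]
    using b by (simp add: oct.scaleR_left oct.scaleR_right oct.add_right oct.minus_left JJ
        scaleR_add_right scaleR_diff_right power2_eq_square)
qed

section \<open>Power series at points of the real axis\<close>

lemma continuous_on_monom_at: "continuous_on X (\<lambda>x. monom_at a x \<alpha>)"
  unfolding monom_at_def by (intro continuous_intros)

text \<open>The Weierstrass test with the weighted coefficients as majorant. Continuity later
  carries the identity with \<open>f\<close> onto the real axis.\<close>

lemma series_bound_continuous_on:
  assumes "series_bound a r M g"
  shows "continuous_on (cube a r) g"
proof -
  obtain c S where c: "((\<lambda>\<alpha>. norm (c \<alpha>) * r ^ mdeg \<alpha>) has_sum S) UNIV"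
    "\<And>x. x \<in> cube a r \<Longrightarrow> ((\<lambda>\<alpha>. monom_at a x \<alpha> *\<^sub>R c \<alpha>) has_sum g x) UNIV"
    using assms unfolding series_bound_def by metis
  have "uniform_limit (cube a r) (\<lambda>X y. \<Sum>\<alpha>\<in>X. monom_at a y \<alpha> *\<^sub>R c \<alpha>) g (finite_subsets_at_top UNIV)"
    by (rule Weierstrass_m_test_general'[OF norm_monom_at_scaleR_le c(2) has_sum_imp_summable[OF c(1)]])
  then show ?thesis
    by (rule uniform_limit_theorem[rotated])
       (auto intro!: always_eventually continuous_intros continuous_on_monom_at)
qed

lemma analytic_near_continuous:
  assumes "analytic_near a g"
  obtains \<rho> where "\<rho> > 0" "continuous_on (ball a \<rho>) g"
  using assms series_bound_continuous_on ball_subset_cube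
  unfolding analytic_near_def by (metis continuous_on_subset)

text \<open>Real part of \<open>(s + \<i> b) ^ n\<close>, and its imaginary part divided by
  \<open>b\<close>, as polynomials in \<open>s\<close> and \<open>t = b\<^sup>2\<close>. With weight
  1 for \<open>s\<close> and 2 for \<open>t\<close> they are homogeneous of degrees \<open>n\<close>
  and \<open>n - 1\<close>, which explains the powers of \<open>\<rho>\<close> in the bounds
  below.\<close>

fun axQ axP :: "nat \<Rightarrow> real \<Rightarrow> real \<Rightarrow> real" where
  "axQ 0 s t = 1"
| "axQ (Suc n) s t = s * axQ n s t - t * axP n s t"
| "axP 0 s t = 0"
| "axP (Suc n) s t = s * axP n s t + axQ n s t"

text \<open>For \<open>\<Phi> = z ^ n\<close> the formula
  \<open>b\<^sup>2 v = b Re \<Phi>' - Im \<Phi>\<close> yields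
  \<open>v / b = (n axQ (n - 1) - axP n) / t\<close>. The recursion produces this quotient without a
  division, as a polynomial of weighted degree \<open>n - 3\<close>.\<close>

fun axT :: "nat \<Rightarrow> real \<Rightarrow> real \<Rightarrow> real" where
  "axT 0 s t = 0"
| "axT (Suc n) s t = s * axT n s t - real n * axP (n - 1) s t"

lemma power_axQ_axP: "Complex s b ^ n = Complex (axQ n s (b\<^sup>2)) (b * axP n s (b\<^sup>2))"
  by (induction n) (auto simp: complex_eq_iff algebra_simps power2_eq_square)

lemma axT_eq: "t * axT n s t = real n * axQ (n - 1) s t - axP n s t"
proof (induction n)
  case (Suc n)
  have "t * axT (Suc n) s t = s * (t * axT n s t) - real n * (t * axP (n - 1) s t)"
    by (simp add: algebra_simps)
  \<comment> \<open>For positive \<open>n\<close> the recursion of \<open>axQ\<close> closes the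
    step; for \<open>n = 0\<close> the factor \<open>real n\<close> hides the truncated
    \<open>n - 1\<close>.\<close>
  also have "\<dots> = real (Suc n) * axQ n s t - axP (Suc n) s t"
    unfolding Suc by (cases n) (simp_all add: algebra_simps)
  finally show ?case by simp
qed simp

definition Im_sq :: "octonion \<Rightarrow> real" where
  "Im_sq y = (norm (oct_Im y))\<^sup>2"

lemma Im_sq_eq: "Im_sq y = (\<Sum>l=1..7. (oct_coord y l)\<^sup>2)"
  unfolding Im_sq_def norm_oct sum_0_7 sum_1_7 by (simp add: oct_coord_Im)

context
  fixes r \<rho> :: real
  assumes \<rho>: "\<rho> > 0"
begin

lemma series_bound_Re: "series_bound (r *\<^sub>R oct_e 0) \<rho> \<rho> (\<lambda>y. of_real (oct_Re y - r))"
  using series_bound_coord[of \<rho> "r *\<^sub>R oct_e 0" "of_nat 0"] \<rho>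
  by (simp add: oct_Re_def oct_coord_def oct_e_def)

lemma series_bound_Im_sq: "series_bound (r *\<^sub>R oct_e 0) \<rho> (7 * \<rho>\<^sup>2) (\<lambda>y. of_real (Im_sq y))"
proof -
  have "series_bound (r *\<^sub>R oct_e 0) \<rho> (\<Sum>l=1..7::nat. \<rho>\<^sup>2) (\<lambda>y. \<Sum>l=1..7. (of_real (oct_coord y l))\<^sup>2)"
  proof (intro series_bound_sum series_bound_power \<rho>)
    fix l :: nat assume l: "l \<in> {1..7}"
    have "oct_coord (r *\<^sub>R oct_e 0) l = 0" using l by (simp add: oct_coord_simps oct_coord_oct_e)
    then have z: "(r *\<^sub>R oct_e 0) $ of_nat l = 0" unfolding oct_coord_def .
    show "series_bound (r *\<^sub>R oct_e 0) \<rho> \<rho> (\<lambda>y. of_real (oct_coord y l))"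
      using series_bound_coord[of \<rho> "r *\<^sub>R oct_e 0" "of_nat l", unfolded z] \<rho> by (simp add: oct_coord_def)
  qed
  then show ?thesis by (simp add: Im_sq_eq)
qed

text \<open>The norm of \<open>s\<close> is at most \<open>\<rho>\<close> and that of the seven
  squares in \<open>b\<^sup>2\<close> at most \<open>7 \<rho>\<^sup>2\<close>; in the recursion of
  \<open>axQ\<close> these add up to the factor \<open>8 \<rho>\<close>.\<close>

lemma series_bound_axQ_axP:
  "series_bound (r *\<^sub>R oct_e 0) \<rho> ((8 * \<rho>) ^ n) (\<lambda>y. of_real (axQ n (oct_Re y - r) (Im_sq y)))"
  "series_bound (r *\<^sub>R oct_e 0) \<rho> ((8 * \<rho>) ^ n / \<rho>) (\<lambda>y. of_real (axP n (oct_Re y - r) (Im_sq y)))"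
proof (induction n)
  case 0
  show "series_bound (r *\<^sub>R oct_e 0) \<rho> ((8 * \<rho>) ^ 0) (\<lambda>y. of_real (axQ 0 (oct_Re y - r) (Im_sq y)))"
    using series_bound_const[of \<rho> _ 1] \<rho> by simp
  show "series_bound (r *\<^sub>R oct_e 0) \<rho> ((8 * \<rho>) ^ 0 / \<rho>) (\<lambda>y. of_real (axP 0 (oct_Re y - r) (Im_sq y)))"
    using series_bound_mono[OF series_bound_const[of \<rho> "r *\<^sub>R oct_e 0" 0], of "1 / \<rho>"] \<rho> by simp
next
  case (Suc n)
  have "series_bound (r *\<^sub>R oct_e 0) \<rho> (\<rho> * (8 * \<rho>) ^ n + 7 * \<rho>\<^sup>2 * (norm (-1::complex) * ((8 * \<rho>) ^ n / \<rho>)))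
      (\<lambda>y. of_real (oct_Re y - r) * of_real (axQ n (oct_Re y - r) (Im_sq y))
        + of_real (Im_sq y) * (-1 * of_real (axP n (oct_Re y - r) (Im_sq y))))"
    by (intro series_bound_add series_bound_mult series_bound_cmult \<rho> series_bound_Re series_bound_Im_sq Suc)
  then show "series_bound (r *\<^sub>R oct_e 0) \<rho> ((8 * \<rho>) ^ Suc n) (\<lambda>y. of_real (axQ (Suc n) (oct_Re y - r) (Im_sq y)))"
    using \<rho> by (simp add: power2_eq_square field_simps)
  have "series_bound (r *\<^sub>R oct_e 0) \<rho> (\<rho> * ((8 * \<rho>) ^ n / \<rho>) + (8 * \<rho>) ^ n)
      (\<lambda>y. of_real (oct_Re y - r) * of_real (axP n (oct_Re y - r) (Im_sq y))
        + of_real (axQ n (oct_Re y - r) (Im_sq y)))"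
    by (intro series_bound_add series_bound_mult \<rho> series_bound_Re Suc)
  then have "series_bound (r *\<^sub>R oct_e 0) \<rho> ((8 * \<rho>) ^ Suc n / \<rho>)
      (\<lambda>y. of_real (oct_Re y - r) * of_real (axP n (oct_Re y - r) (Im_sq y))
        + of_real (axQ n (oct_Re y - r) (Im_sq y)))"
    by (rule series_bound_mono) (use \<rho> in \<open>simp add: field_simps\<close>)
  then show "series_bound (r *\<^sub>R oct_e 0) \<rho> ((8 * \<rho>) ^ Suc n / \<rho>) (\<lambda>y. of_real (axP (Suc n) (oct_Re y - r) (Im_sq y)))"
    by simp
qed

text \<open>The inhomogeneous term of the recursion carries a factor \<open>n\<close>; its
  accumulation over \<open>n\<close> steps is absorbed by \<open>n\<^sup>2\<close>.\<close>

lemma series_bound_axT: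
  "series_bound (r *\<^sub>R oct_e 0) \<rho> ((real n)\<^sup>2 * (8 * \<rho>) ^ n / \<rho> ^ 3) (\<lambda>y. of_real (axT n (oct_Re y - r) (Im_sq y)))"
proof (induction n)
  case 0
  show ?case using series_bound_const[of \<rho> _ 0] \<rho> by simp
next
  case (Suc n)
  have "series_bound (r *\<^sub>R oct_e 0) \<rho> (\<rho> * ((real n)\<^sup>2 * (8 * \<rho>) ^ n / \<rho> ^ 3) + norm (- of_nat n :: complex) * ((8 * \<rho>) ^ (n - 1) / \<rho>))
      (\<lambda>y. of_real (oct_Re y - r) * of_real (axT n (oct_Re y - r) (Im_sq y))
        + (- of_nat n) * of_real (axP (n - 1) (oct_Re y - r) (Im_sq y)))"
    by (intro series_bound_add series_bound_mult series_bound_cmult \<rho> series_bound_Re Suc series_bound_axQ_axP)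
  moreover have "\<rho> * ((real n)\<^sup>2 * (8 * \<rho>) ^ n / \<rho> ^ 3) + norm (- of_nat n :: complex) * ((8 * \<rho>) ^ (n - 1) / \<rho>)
      \<le> (real (Suc n))\<^sup>2 * (8 * \<rho>) ^ Suc n / \<rho> ^ 3"
  proof -
    have "real n * (8 * \<rho>) ^ (n - 1) \<le> real n * ((8 * \<rho>) ^ n / \<rho>)"
      using \<rho> by (cases n) (auto simp: field_simps)
    then have 1: "real n * ((8 * \<rho>) ^ (n - 1) / \<rho>) \<le> real n * ((8 * \<rho>) ^ n / \<rho>\<^sup>2)"
      using \<rho> by (simp add: field_simps power2_eq_square)
    have 2: "\<rho> * ((real n)\<^sup>2 * (8 * \<rho>) ^ n / \<rho> ^ 3) = (real n)\<^sup>2 * ((8 * \<rho>) ^ n / \<rho>\<^sup>2)"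
      using \<rho> by (simp add: power2_eq_square power3_eq_cube)
    have 3: "((real n)\<^sup>2 + real n) * ((8 * \<rho>) ^ n / \<rho>\<^sup>2) \<le> (8 * (real (Suc n))\<^sup>2) * ((8 * \<rho>) ^ n / \<rho>\<^sup>2)"
      using \<rho> by (intro mult_right_mono) (auto simp: power2_eq_square algebra_simps)
    have 4: "(real (Suc n))\<^sup>2 * (8 * \<rho>) ^ Suc n / \<rho> ^ 3 = (8 * (real (Suc n))\<^sup>2) * ((8 * \<rho>) ^ n / \<rho>\<^sup>2)"
      using \<rho> by (simp add: power2_eq_square power3_eq_cube)
    show ?thesis
      unfolding norm_minus_cancel norm_of_nat 2 4 using 1 3 unfolding distrib_right by linarith
  qed
  ultimately have "series_bound (r *\<^sub>R oct_e 0) \<rho> ((real (Suc n))\<^sup>2 * (8 * \<rho>) ^ Suc n / \<rho> ^ 3)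
      (\<lambda>y. of_real (oct_Re y - r) * of_real (axT n (oct_Re y - r) (Im_sq y))
        + (- of_nat n) * of_real (axP (n - 1) (oct_Re y - r) (Im_sq y)))"
    by (rule series_bound_mono)
  then show ?case by simp
qed

end

text \<open>Absorbs the factor \<open>n\<^sup>2\<close> at the cost of doubling the radius from
  \<open>8 \<rho>\<close> to \<open>16 \<rho>\<close>.\<close>

lemma square_le_two_power: "(real n)\<^sup>2 \<le> 2 * 2 ^ n"
proof (induction n rule: less_induct)
  case (less n)
  show ?case
  proof (cases "n < 4")
    case True
    then have "n \<in> {0, 1, 2, 3}" by auto
    then show ?thesis by auto
  next
    case False
    then obtain m where m: "n = Suc m" "m \<ge> 3" by (cases n) auto
    have "3 * real m \<le> real m * real m" using m by (intro mult_right_mono) auto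
    then have "1 + 2 * real m \<le> real m * real m" using m by linarith
    then have "(real n)\<^sup>2 \<le> 2 * (real m)\<^sup>2" using m by (simp add: power2_eq_square algebra_simps)
    also have "\<dots> \<le> 2 * (2 * 2 ^ m)" using less[of m] m by simp
    finally show ?thesis using m by simp
  qed
qed

text \<open>Only the real parts of the Taylor coefficients at \<open>r\<close> survive symmetrization under
  conjugation, which leaves power series in \<open>s\<close> and \<open>b\<^sup>2\<close>.\<close>

lemma symmetrized_series_analytic:
  assumes hol: "\<Phi> holomorphic_on ball (of_real r) R" and R: "R > 0"
  obtains U V :: "octonion \<Rightarrow> real" and \<rho> where "\<rho> > 0"
    "analytic_near (r *\<^sub>R oct_e 0) (\<lambda>y. of_real (U y))"
    "analytic_near (r *\<^sub>R oct_e 0) (\<lambda>y. of_real (V y))"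
    "\<And>y. y \<in> ball (r *\<^sub>R oct_e 0) \<rho> \<Longrightarrow> oct_Im y \<noteq> 0 \<Longrightarrow>
      2 * norm (oct_Im y) * U y = Im (deriv \<Phi> (half_plane y)) - Im (deriv \<Phi> (cnj (half_plane y)))"
    "\<And>y. y \<in> ball (r *\<^sub>R oct_e 0) \<rho> \<Longrightarrow> oct_Im y \<noteq> 0 \<Longrightarrow>
      2 * norm (oct_Im y) ^ 3 * V y =
        norm (oct_Im y) * (Re (deriv \<Phi> (half_plane y)) + Re (deriv \<Phi> (cnj (half_plane y))))
        - (Im (\<Phi> (half_plane y)) - Im (\<Phi> (cnj (half_plane y))))"
proof -
  define d where "d = (\<lambda>n. (deriv ^^ n) \<Phi> (of_real r) / fact n)"
  have ser: "(\<lambda>n. d n * (z - of_real r) ^ n) sums \<Phi> z" if "z \<in> ball (of_real r) R" for z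
    unfolding d_def using holomorphic_power_series[OF hol that] .
  have hol': "deriv \<Phi> holomorphic_on ball (of_real r) R"
    by (rule holomorphic_deriv[OF hol]) simp
  have d': "(deriv ^^ n) (deriv \<Phi>) (of_real r) / fact n = of_nat (Suc n) * d (Suc n)" for n
  proof -
    have "(deriv ^^ n) (deriv \<Phi>) = (deriv ^^ Suc n) \<Phi>" by (simp only: funpow_Suc_right o_apply)
    then show ?thesis by (simp add: d_def del: funpow.simps of_nat_Suc)
  qed
  have ser': "(\<lambda>n. of_nat (Suc n) * d (Suc n) * (z - of_real r) ^ n) sums deriv \<Phi> z" if "z \<in> ball (of_real r) R" for z
    using holomorphic_power_series[OF hol' that] unfolding d' .
  \<comment> \<open>Absolute convergence of the Taylor series is needed at radius
    \<open>16 \<rho>\<close>; with this choice the comparison point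
    \<open>24 \<rho> = 3 R / 4\<close> is still inside the disc.\<close>
  define \<rho> where "\<rho> = R / 32"
  have \<rho>: "\<rho> > 0" "\<rho> < R" using R by (auto simp: \<rho>_def)
  define e where "e = (\<lambda>n. Re (d n))"
  have ed: "\<bar>e n\<bar> \<le> norm (d n)" for n by (simp add: e_def abs_Re_le_cmod)
  have "summable (\<lambda>n. norm (d n * of_real (16 * \<rho>) ^ n))"
  proof (rule powser_insidea[where x = "of_real (24 * \<rho>)"])
    have "of_real r + of_real (24 * \<rho>) \<in> ball (complex_of_real r) R"
      using R by (simp add: dist_norm \<rho>_def norm_mult)
    from sums_summable[OF ser[OF this]] show "summable (\<lambda>n. d n * of_real (24 * \<rho>) ^ n)" by simp
  qed (use \<rho> in \<open>simp add: norm_mult\<close>)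
  then have s16: "summable (\<lambda>n. norm (d n) * (16 * \<rho>) ^ n)"
    using \<rho> by (simp add: norm_mult norm_power)
  have "summable (\<lambda>n. (real n)\<^sup>2 * (8 * \<rho>) ^ n * \<bar>e n\<bar>)"
  proof (rule summable_comparison_test'[OF summable_mult[OF s16, of 2]])
    fix n
    have "(real n)\<^sup>2 * (8 * \<rho>) ^ n * \<bar>e n\<bar> \<le> (2 * 2 ^ n) * (8 * \<rho>) ^ n * norm (d n)"
      by (intro mult_mono square_le_two_power ed) (use \<rho> in auto)
    also have "\<dots> = 2 * (norm (d n) * (16 * \<rho>) ^ n)"
    proof -
      have "2 ^ n * (8 * \<rho>) ^ n = (16 * \<rho>) ^ n" by (subst power_mult_distrib[symmetric]) simp
      then show ?thesis by (metis mult.assoc mult.commute)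
    qed
    finally show "norm ((real n)\<^sup>2 * (8 * \<rho>) ^ n * \<bar>e n\<bar>) \<le> 2 * (norm (d n) * (16 * \<rho>) ^ n)"
      using \<rho> by simp
  qed
  then have s8: "summable (\<lambda>n. (real (Suc n))\<^sup>2 * (8 * \<rho>) ^ Suc n * \<bar>e (Suc n)\<bar>)"
    by (subst (asm) summable_Suc_iff[symmetric])
  define MV where "MV = (\<lambda>n. norm (of_real (e (Suc n)) :: complex) * ((real (Suc n))\<^sup>2 * (8 * \<rho>) ^ Suc n / \<rho> ^ 3))"
  define MU where "MU = (\<lambda>n. norm (of_real (real (Suc n) * e (Suc n)) :: complex) * ((8 * \<rho>) ^ n / \<rho>))"
  have sMV: "summable MV"
    using summable_mult[OF s8, of "1 / \<rho> ^ 3"] by (simp add: MV_def mult_ac)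
  have sMU: "summable MU"
  proof (rule summable_comparison_test'[OF summable_mult[OF s8, of "1 / \<rho>\<^sup>2"]])
    fix n
    have "MU n = (real (Suc n) * (8 * \<rho>) ^ n / \<rho>) * \<bar>e (Suc n)\<bar>"
      by (simp add: MU_def abs_mult del: of_real_mult of_nat_Suc)
    also have "\<dots> \<le> (1 / \<rho>\<^sup>2 * ((real (Suc n))\<^sup>2 * (8 * \<rho>) ^ Suc n)) * \<bar>e (Suc n)\<bar>"
    proof (rule mult_right_mono)
      have "real (Suc n) * ((8 * \<rho>) ^ n / \<rho>) \<le> (8 * (real (Suc n))\<^sup>2) * ((8 * \<rho>) ^ n / \<rho>)"
        using \<rho> by (intro mult_right_mono) (auto simp: power2_eq_square algebra_simps)
      also have "\<dots> = 1 / \<rho>\<^sup>2 * ((real (Suc n))\<^sup>2 * (8 * \<rho>) ^ Suc n)"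
        using \<rho> by (simp add: power2_eq_square)
      finally show "real (Suc n) * (8 * \<rho>) ^ n / \<rho> \<le> 1 / \<rho>\<^sup>2 * ((real (Suc n))\<^sup>2 * (8 * \<rho>) ^ Suc n)" by simp
    qed simp
    finally show "norm (MU n) \<le> 1 / \<rho>\<^sup>2 * ((real (Suc n))\<^sup>2 * (8 * \<rho>) ^ Suc n * \<bar>e (Suc n)\<bar>)"
      using \<rho> by (simp add: MU_def mult.assoc)
  qed
  \<comment> \<open>The \<open>n\<close>-th terms belong to the Taylor coefficient of index
    \<open>n + 1\<close>: the derivative loses index 0, and \<open>axT 0\<close> vanishes.\<close>
  define u where "u = (\<lambda>n y. real (Suc n) * e (Suc n) * axP n (oct_Re y - r) (Im_sq y))"
  define v where "v = (\<lambda>n y. e (Suc n) * axT (Suc n) (oct_Re y - r) (Im_sq y))"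
  have bu: "series_bound (r *\<^sub>R oct_e 0) \<rho> (MU n) (\<lambda>y. of_real (u n y))" for n
    unfolding MU_def u_def of_real_mult[of "real (Suc n) * e (Suc n)"]
    by (intro series_bound_cmult series_bound_axQ_axP \<rho>)
  have bv: "series_bound (r *\<^sub>R oct_e 0) \<rho> (MV n) (\<lambda>y. of_real (v n y))" for n
    unfolding MV_def v_def of_real_mult
    by (intro series_bound_cmult series_bound_axT \<rho>)
  have sums_in_cube: "(\<lambda>n. w n y) sums (\<Sum>n. w n y)"
    if "\<And>n. series_bound (r *\<^sub>R oct_e 0) \<rho> (M n) (\<lambda>y. of_real (w n y))" "summable M" "y \<in> cube (r *\<^sub>R oct_e 0) \<rho>"
    for w :: "nat \<Rightarrow> octonion \<Rightarrow> real" and M y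
    using series_bound_norm_le[OF that(1,3)]
    by (intro summable_sums summable_comparison_test'[OF that(2), of 0]) simp
  have su: "(\<lambda>n. u n y) sums (\<Sum>n. u n y)" and sv: "(\<lambda>n. v n y) sums (\<Sum>n. v n y)"
    if "y \<in> cube (r *\<^sub>R oct_e 0) \<rho>" for y
    using sums_in_cube[OF bu sMU that] sums_in_cube[OF bv sMV that] by auto
  have an: "analytic_near (r *\<^sub>R oct_e 0) (\<lambda>y. of_real (\<Sum>n. u n y))"
    "analytic_near (r *\<^sub>R oct_e 0) (\<lambda>y. of_real (\<Sum>n. v n y))"
    unfolding analytic_near_def
    using series_bound_sums[OF \<rho>(1) bu sMU sums_of_real[OF su]] series_bound_sums[OF \<rho>(1) bv sMV sums_of_real[OF sv]] \<rho>(1) by blast+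
  show thesis
  proof (rule that[OF \<rho>(1) an])
    fix y assume y: "y \<in> ball (r *\<^sub>R oct_e 0) \<rho>" and nz: "oct_Im y \<noteq> 0"
    define s b z where "s = oct_Re y - r" and "b = norm (oct_Im y)" and "z = half_plane y"
    have b: "b > 0" using nz by (simp add: b_def)
    have yc: "y \<in> cube (r *\<^sub>R oct_e 0) \<rho>" using y ball_subset_cube by blast
    have zs: "z - of_real r = Complex s b" "cnj z - of_real r = cnj (Complex s b)"
      by (simp_all add: complex_eq_iff z_def s_def b_def)
    have "norm (z - of_real r) = norm (y - r *\<^sub>R oct_e 0)"
    proof -
      have "(norm (y - r *\<^sub>R oct_e 0))\<^sup>2 = s\<^sup>2 + b\<^sup>2"
        unfolding b_def norm_oct sum_0_7
        by (simp add: s_def oct_Re_def oct_coord_simps oct_coord_oct_e oct_coord_Im)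
      then have "(norm (y - r *\<^sub>R oct_e 0))\<^sup>2 = (norm (z - of_real r))\<^sup>2"
        by (simp add: zs cmod_power2)
      then show ?thesis by (simp add: power2_eq_iff_nonneg)
    qed
    moreover have "norm (cnj z - of_real r) = norm (z - of_real r)"
      by (simp only: zs complex_mod_cnj)
    ultimately have zR: "z \<in> ball (of_real r) R" "cnj z \<in> ball (of_real r) R"
      using y \<rho>(2) by (auto simp: dist_norm norm_minus_commute)
    have pw: "Complex s b ^ n = Complex (axQ n s (b\<^sup>2)) (b * axP n s (b\<^sup>2))" for n
      by (rule power_axQ_axP)
    have cpw: "cnj (Complex s b) ^ n = Complex (axQ n s (b\<^sup>2)) (- b * axP n s (b\<^sup>2))" for n
      by (simp add: pw complex_eq_iff flip: complex_cnj_power)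
    have bsq: "Im_sq y = b\<^sup>2" by (simp add: Im_sq_def b_def)
    note S' = ser'[OF zR(1), unfolded zs pw] ser'[OF zR(2), unfolded zs cpw]
    note S = ser[OF zR(1), unfolded zs pw] ser[OF zR(2), unfolded zs cpw]
    \<comment> \<open>Conjugation negates only the factor \<open>b\<close>, so the imaginary parts
      of the coefficients cancel in the difference of the imaginary parts.\<close>
    have "(\<lambda>n. 2 * b * u n y) sums (Im (deriv \<Phi> z) - Im (deriv \<Phi> (cnj z)))"
      using sums_diff[OF sums_Im[OF S'(1)] sums_Im[OF S'(2)]]
      by (simp add: u_def e_def bsq s_def[symmetric] algebra_simps)
    then show "2 * norm (oct_Im y) * (\<Sum>n. u n y) = Im (deriv \<Phi> (half_plane y)) - Im (deriv \<Phi> (cnj (half_plane y)))"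
      using sums_mult[OF su[OF yc], of "2 * b"] sums_unique2 unfolding b_def z_def by blast
    have "(\<lambda>n. 2 * b * (e n * axP n s (b\<^sup>2))) sums (Im (\<Phi> z) - Im (\<Phi> (cnj z)))"
      using sums_diff[OF sums_Im[OF S(1)] sums_Im[OF S(2)]]
      by (simp add: e_def algebra_simps)
    \<comment> \<open>The term of index 0 is zero, since \<open>axP 0 = 0\<close>; dropping it
      aligns this series with that of the derivative.\<close>
    then have "(\<lambda>n. 2 * b * (e (Suc n) * axP (Suc n) s (b\<^sup>2))) sums (Im (\<Phi> z) - Im (\<Phi> (cnj z)))"
      by (subst sums_Suc_iff) simp
    moreover have "(\<lambda>n. 2 * (real (Suc n) * e (Suc n) * axQ n s (b\<^sup>2))) sums (Re (deriv \<Phi> z) + Re (deriv \<Phi> (cnj z)))"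
      using sums_add[OF sums_Re[OF S'(1)] sums_Re[OF S'(2)]]
      by (simp add: e_def algebra_simps)
    ultimately have "(\<lambda>n. b * (2 * (real (Suc n) * e (Suc n) * axQ n s (b\<^sup>2))) - 2 * b * (e (Suc n) * axP (Suc n) s (b\<^sup>2)))
        sums (b * (Re (deriv \<Phi> z) + Re (deriv \<Phi> (cnj z))) - (Im (\<Phi> z) - Im (\<Phi> (cnj z))))"
      by (intro sums_diff sums_mult)
    \<comment> \<open>\<open>axT_eq\<close> extracts a further factor \<open>b\<^sup>2\<close>,
      which makes the quotient by \<open>b ^ 3\<close> a power series.\<close>
    moreover have "b * (2 * (real (Suc n) * e (Suc n) * axQ n s (b\<^sup>2))) - 2 * b * (e (Suc n) * axP (Suc n) s (b\<^sup>2)) = 2 * b ^ 3 * v n y" for n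
    proof -
      have "2 * b ^ 3 * v n y = 2 * b * e (Suc n) * (b\<^sup>2 * axT (Suc n) s (b\<^sup>2))"
        by (simp only: v_def bsq s_def[symmetric] power2_eq_square power3_eq_cube mult_ac)
      also have "\<dots> = b * (2 * (real (Suc n) * e (Suc n) * axQ n s (b\<^sup>2))) - 2 * b * (e (Suc n) * axP (Suc n) s (b\<^sup>2))"
        unfolding axT_eq by (simp add: algebra_simps)
      finally show ?thesis by simp
    qed
    ultimately have "(\<lambda>n. 2 * b ^ 3 * v n y) sums (b * (Re (deriv \<Phi> z) + Re (deriv \<Phi> (cnj z))) - (Im (\<Phi> z) - Im (\<Phi> (cnj z))))"
      by simp
    then show "2 * norm (oct_Im y) ^ 3 * (\<Sum>n. v n y) =
        norm (oct_Im y) * (Re (deriv \<Phi> (half_plane y)) + Re (deriv \<Phi> (cnj (half_plane y))))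
        - (Im (\<Phi> (half_plane y)) - Im (\<Phi> (cnj (half_plane y))))"
      using sums_mult[OF sv[OF yc], of "2 * b ^ 3"] sums_unique2 unfolding b_def z_def by blast
  qed
qed

section \<open>Analyticity of \<open>|Im x|\<close> and \<open>half_plane\<close> off the real
  axis\<close>

lemma analytic_near_norm_Im:
  assumes "oct_Im a \<noteq> 0"
  shows "analytic_near a (\<lambda>y. of_real (norm (oct_Im y)))"
proof -
  have "analytic_near a (\<lambda>y. \<Sum>l=1..7. of_real (oct_coord y l) * of_real (oct_coord y l))"
    unfolding oct_coord_def by (intro analytic_near_sum analytic_near_mult analytic_near_coord)
  then have an: "analytic_near a (\<lambda>y. of_real (Im_sq y))"
    by (simp add: Im_sq_eq power2_eq_square)
  have hol: "csqrt holomorphic_on - \<real>\<^sub>\<le>\<^sub>0"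
    by (rule holomorphic_on_csqrt)
  have "complex_of_real (Im_sq a) \<in> - \<real>\<^sub>\<le>\<^sub>0"
    using assms by (simp add: Im_sq_def complex_nonpos_Reals_iff del: of_real_power)
  from analytic_near_compose[OF an hol _ this]
  have "analytic_near a (\<lambda>y. csqrt (of_real (Im_sq y)))"
    by (simp add: open_Compl closed_nonpos_Reals_complex)
  then show ?thesis by (simp add: Im_sq_def flip: of_real_sqrt)
qed

lemma analytic_near_inverse_norm_Im:
  assumes "oct_Im a \<noteq> 0"
  shows "analytic_near a (\<lambda>y. of_real (1 / norm (oct_Im y)))"
proof -
  have "analytic_near a (\<lambda>y. inverse (of_real (norm (oct_Im y))))"
    by (rule analytic_near_compose[OF analytic_near_norm_Im[OF assms], where U = "- {0}"])
       (use assms in \<open>auto intro!: holomorphic_intros\<close>)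
  then show ?thesis by (simp add: divide_inverse)
qed

lemma analytic_near_half_plane:
  assumes "oct_Im a \<noteq> 0"
  shows "analytic_near a half_plane"
proof -
  have "analytic_near a (\<lambda>y. of_real (oct_Re y))"
    unfolding oct_Re_def oct_coord_def by (rule analytic_near_coord)
  then have "analytic_near a (\<lambda>y. of_real (oct_Re y) + \<i> * of_real (norm (oct_Im y)))"
    by (intro analytic_near_add analytic_near_mult analytic_near_const analytic_near_norm_Im assms)
  moreover have "(\<lambda>y. of_real (oct_Re y) + \<i> * of_real (norm (oct_Im y))) = half_plane"
    by (simp add: fun_eq_iff complex_eq_iff)
  ultimately show ?thesis by (simp only:)
qed

section \<open>Slices and stem functions\<close>

definition slice_point :: "octonion \<Rightarrow> complex \<Rightarrow> octonion" where
  "slice_point I z = Re z *\<^sub>R oct_e 0 + Im z *\<^sub>R I"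

lemma oct_sphere_Im: "I \<in> oct_sphere \<Longrightarrow> oct_Im I = I"
  by (simp add: oct_sphere_def oct_Im_eq)

lemma oct_Re_linear:
  "oct_Re (x + y) = oct_Re x + oct_Re y" "oct_Re (x - y) = oct_Re x - oct_Re y"
  "oct_Re (c *\<^sub>R x) = c * oct_Re x" "oct_Re (- x) = - oct_Re x"
  by (simp_all add: oct_Re_def oct_coord_simps)

lemma oct_Re_e0 [simp]: "oct_Re (oct_e 0) = 1"
  by (simp add: oct_Re_def oct_coord_oct_e)

lemma oct_Re_Im_0 [simp]: "oct_Re (oct_Im x) = 0"
  by (simp add: oct_Im_eq oct_Re_linear)

lemma oct_Re_slice_point: "I \<in> oct_sphere \<Longrightarrow> oct_Re (slice_point I z) = Re z"
  by (simp add: slice_point_def oct_Re_linear oct_sphere_def)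

lemma oct_Im_slice_point: "I \<in> oct_sphere \<Longrightarrow> oct_Im (slice_point I z) = Im z *\<^sub>R I"
  by (simp add: oct_Im_eq oct_Re_slice_point) (simp add: slice_point_def)

lemma norm_slice_point: "I \<in> oct_sphere \<Longrightarrow> norm (slice_point I z) = norm z"
proof -
  assume I: "I \<in> oct_sphere"
  then have "oct_e 0 \<bullet> I = 0" "I \<bullet> I = 1"
    by (simp_all add: oct_sphere_def oct_Re_def oct_coord_eq_inner inner_commute norm_eq_1)
  moreover have "oct_e 0 \<bullet> oct_e 0 = 1" using norm_oct_e[of 0] by (simp add: norm_eq_1)
  ultimately have "(norm (slice_point I z))\<^sup>2 = (norm z)\<^sup>2"
    unfolding power2_norm_eq_inner
    by (simp add: slice_point_def inner_add_left inner_add_right inner_commute inner_complex_def)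
  then show ?thesis by (simp add: power2_eq_iff_nonneg)
qed

lemma slice_point_diff: "slice_point I z - slice_point I w = slice_point I (z - w)"
  by (simp add: slice_point_def algebra_simps)

lemma slice_point_uminus: "slice_point (- I) z = slice_point I (cnj z)"
  by (simp add: slice_point_def)

lemma half_plane_slice_point: "I \<in> oct_sphere \<Longrightarrow> Im z \<ge> 0 \<Longrightarrow> half_plane (slice_point I z) = z"
  using oct_Re_slice_point[of I z] oct_Im_slice_point[of I z]
  by (simp add: complex_eq_iff) (simp add: oct_sphere_def)

lemma sgn_oct_Im_in_sphere: "oct_Im y \<noteq> 0 \<Longrightarrow> sgn (oct_Im y) \<in> oct_sphere"
  by (simp add: oct_sphere_def norm_sgn sgn_div_norm oct_Re_linear)

lemma slice_point_half_plane: "slice_point (sgn (oct_Im y)) (half_plane y) = y"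
  using oct_Re_Im[of y] by (cases "oct_Im y = 0") (simp_all add: slice_point_def sgn_div_norm)

text \<open>Normalization maps the punctured hyperplane of imaginary octonions, which is connected
  because its dimension is not 1, onto the unit sphere.\<close>

lemma connected_oct_sphere: "connected oct_sphere"
proof -
  let ?H = "{x. oct_e 0 \<bullet> x = 0}"
  have e0: "oct_e 0 \<noteq> 0" using norm_oct_e[of 0] by auto
  have "aff_dim ?H \<noteq> 1"
    using aff_dim_hyperplane[OF e0, of 0] by simp
  then have "connected (?H - {0})"
    by (intro connected_punctured_convex convex_hyperplane)
  then have "connected (sgn ` (?H - {0}))"
    by (rule connected_continuous_image[rotated]) (auto intro!: continuous_intros)
  moreover have "sgn ` (?H - {0}) = oct_sphere"
  proof (intro equalityI subsetI)
    fix I assume "I \<in> oct_sphere"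
    then have "I = sgn I" "I \<in> ?H - {0}"
      by (auto simp: oct_sphere_def sgn_div_norm oct_Re_def oct_coord_eq_inner inner_commute)
    then show "I \<in> sgn ` (?H - {0})" by blast
  qed (auto simp: oct_sphere_def norm_sgn oct_Re_def oct_coord_eq_inner inner_commute sgn_div_norm)
  ultimately show ?thesis by simp
qed

lemma oct_e_in_sphere: "l \<in> {1..7} \<Longrightarrow> oct_e l \<in> oct_sphere"
  by (simp add: oct_sphere_def norm_oct_e oct_Re_e)

lemma oct_sphere_uminus: "I \<in> oct_sphere \<Longrightarrow> - I \<in> oct_sphere"
  by (simp add: oct_sphere_def oct_Re_linear)

text \<open>A connected set of units lies in a single component of \<open>slice_sphere\<close>, so
  one pair \<open>(u, v)\<close> serves all of it.\<close>

lemma slice_function_connected: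
  assumes f: "slice_function \<Omega> f" and z: "Im z > 0"
    and C: "connected C" "C \<subseteq> oct_sphere" and sub: "\<And>I. I \<in> C \<Longrightarrow> slice_point I z \<in> \<Omega>"
  shows "\<exists>u v. \<forall>I\<in>C. f (slice_point I z) = u + I \<odot> v"
proof (cases "C = {}")
  case False
  then obtain I0 where I0: "I0 \<in> C" by blast
  let ?S = "slice_sphere \<Omega> (Re z) (Im z)"
  have CS: "C \<subseteq> ?S" using C(2) sub by (auto simp: slice_sphere_def slice_point_def)
  have "connected_component_set ?S I0 \<in> components ?S"
    using I0 CS by (intro componentsI) auto
  then obtain u v where "\<forall>I\<in>connected_component_set ?S I0. f (slice_point I z) = u + I \<odot> v"
    using f z unfolding slice_function_def slice_point_def by blast
  then show ?thesis
    using connected_component_maximal[OF I0 C(1) CS] by blast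
qed simp

text \<open>The solution of \<open>p = u + I0 v\<close>, \<open>q = u + I1 v\<close>: subtraction
  gives \<open>q - p = (I1 - I0) v\<close>, and the inverse of an imaginary \<open>w\<close> is
  \<open>- w / |w|\<^sup>2\<close>. Being linear in \<open>(p, q)\<close>, it inherits
  differentiability and continuity from the values of \<open>f\<close>.\<close>

definition stem_v :: "octonion \<Rightarrow> octonion \<Rightarrow> octonion \<Rightarrow> octonion \<Rightarrow> octonion" where
  "stem_v I0 I1 p q = - (1 / (norm (I1 - I0))\<^sup>2) *\<^sub>R ((I1 - I0) \<odot> (q - p))"

definition stem_u :: "octonion \<Rightarrow> octonion \<Rightarrow> octonion \<Rightarrow> octonion \<Rightarrow> octonion" where
  "stem_u I0 I1 p q = p - I0 \<odot> stem_v I0 I1 p q"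

lemma stem_unique:
  assumes "I0 \<in> oct_sphere" "I1 \<in> oct_sphere" "I0 \<noteq> I1" "p = u + I0 \<odot> v" "q = u + I1 \<odot> v"
  shows "stem_v I0 I1 p q = v" "stem_u I0 I1 p q = u"
proof -
  have "q - p = (I1 - I0) \<odot> v" using assms by (simp add: oct.diff_left)
  moreover have "oct_Re (I1 - I0) = 0" using assms by (simp add: oct_sphere_def oct_Re_linear)
  ultimately show "stem_v I0 I1 p q = v"
    using oct_imaginary_square_mult[of "I1 - I0" v] assms(3) by (simp add: stem_v_def)
  then show "stem_u I0 I1 p q = u" using assms(4) by (simp add: stem_u_def)
qed

lemma bounded_linear_stem_v: "bounded_linear (\<lambda>x. stem_v I0 I1 (fst x) (snd x))"
  unfolding stem_v_def
  by (intro bounded_linear_scaleR_right[THEN bounded_linear_compose] oct.bounded_linear_right[THEN bounded_linear_compose]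
      bounded_linear_sub bounded_linear_fst bounded_linear_snd)

lemma bounded_linear_stem_u: "bounded_linear (\<lambda>x. stem_u I0 I1 (fst x) (snd x))"
  unfolding stem_u_def
  by (intro oct.bounded_linear_right[THEN bounded_linear_compose]
      bounded_linear_sub bounded_linear_fst bounded_linear_stem_v)

text \<open>For \<open>I0 = - J\<close> and \<open>I1 = J\<close>, conjugating \<open>z\<close>
  exchanges the two values; this is the source of the parity in \<open>b\<close>. The version with
  signs serves the derivatives along the units.\<close>

lemma stem_swap:
  "stem_v (- J) J q p = - stem_v (- J) J p q"
  "stem_v (- J) J (- p) (- q) = - stem_v (- J) J p q"
  by (simp_all add: stem_v_def oct.diff_right oct.minus_right scaleR_diff_right)

lemma stem_u_swap:
  assumes "J \<in> oct_sphere"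
  shows "stem_u (- J) J q p = stem_u (- J) J p q"
    and "stem_u (- J) J (- p) (- q) = - stem_u (- J) J p q"
proof -
  have JJ: "J - - J = 2 *\<^sub>R J" by (simp only: scaleR_2 diff_minus_eq_add)
  have n: "norm J = 1" using assms by (simp add: oct_sphere_def)
  have "J \<odot> (J \<odot> w) = - w" for w
    using oct_imaginary_square_mult[of J w] assms by (simp add: oct_sphere_def)
  then have "stem_u (- J) J p q = p + (1 / 2) *\<^sub>R (q - p)" for p q
    unfolding stem_u_def stem_v_def JJ by (simp add: n oct.minus_left oct.scaleR_left oct.scaleR_right oct.minus_right)
  moreover have "p + (1 / 2) *\<^sub>R (q - p) = (1 / 2) *\<^sub>R (p + q)" for p q :: octonion
    by (rule oct_eqI) (simp add: oct_coord_simps field_simps)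
  ultimately have "stem_u (- J) J p q = (1 / 2) *\<^sub>R (p + q)" for p q by simp
  then show "stem_u (- J) J q p = stem_u (- J) J p q" "stem_u (- J) J (- p) (- q) = - stem_u (- J) J p q"
    by (simp_all add: add.commute scaleR_diff_right scaleR_add_right)
qed

lemma slice_point_has_derivative:
  assumes "(f has_derivative blinfun_apply (f' (slice_point I z))) (at (slice_point I z))"
  shows "((\<lambda>z. f (slice_point I z)) has_derivative
     (\<lambda>h. Re h *\<^sub>R f' (slice_point I z) (oct_e 0) + Im h *\<^sub>R f' (slice_point I z) I)) (at z)"
proof -
  have "(slice_point I has_derivative (\<lambda>h. Re h *\<^sub>R oct_e 0 + Im h *\<^sub>R I)) (at z)"
    unfolding slice_point_def [abs_def] by (auto intro!: derivative_eq_intros)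
  from has_derivative_compose[OF this assms] show ?thesis
    by (simp add: blinfun.add_right blinfun.scaleR_right)
qed

lemma stem_pair_derivative:
  assumes L: "bounded_linear (\<lambda>x. L (fst x) (snd x))"
    and "(F has_derivative (\<lambda>h. Re h *\<^sub>R F1 + Im h *\<^sub>R F2)) (at z)"
    and "(G has_derivative (\<lambda>h. Re h *\<^sub>R G1 + Im h *\<^sub>R G2)) (at z)"
  shows "((\<lambda>z. L (F z) (G z)) has_derivative (\<lambda>h. Re h *\<^sub>R L F1 G1 + Im h *\<^sub>R L F2 G2)) (at z)"
proof -
  have "((\<lambda>z. L (F z) (G z)) has_derivative
      (\<lambda>h. L (Re h *\<^sub>R F1 + Im h *\<^sub>R F2) (Re h *\<^sub>R G1 + Im h *\<^sub>R G2))) (at z)"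
    using bounded_linear.has_derivative[OF L has_derivative_Pair[OF assms(2,3)]] by simp
  moreover have "L (a *\<^sub>R p + b *\<^sub>R q) (a *\<^sub>R p' + b *\<^sub>R q') = a *\<^sub>R L p p' + b *\<^sub>R L q q'" for a b p q p' q'
    using linear_add[OF bounded_linear.linear[OF L], of "(a *\<^sub>R p, a *\<^sub>R p')" "(b *\<^sub>R q, b *\<^sub>R q')"]
      linear_scale[OF bounded_linear.linear[OF L], of a "(p, p')"] linear_scale[OF bounded_linear.linear[OF L], of b "(q, q')"]
    by simp
  ultimately show ?thesis by simp
qed

lemma stem_pair_continuous:
  assumes L: "bounded_linear (\<lambda>x. L (fst x) (snd x))" and "continuous_on D F" "continuous_on D G"
  shows "continuous_on D (\<lambda>z. L (F z) (G z))"
  using bounded_linear.continuous_on[OF L continuous_on_Pair[OF assms(2,3)]] by simp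

text \<open>\<open>dbar_F_axial\<close> gives \<open>A + I B = 0\<close> for both units with the
  same \<open>A\<close> and \<open>B\<close>. Hence \<open>(I1 - I0) B = 0\<close>, and left
  multiplication by a nonzero imaginary octonion is injective.\<close>

lemma axial_equations:
  fixes u v :: "complex \<Rightarrow> octonion"
  assumes z: "Im z > 0" and I: "I0 \<in> oct_sphere" "I1 \<in> oct_sphere" "I0 \<noteq> I1"
    and u: "(u has_derivative (\<lambda>h. Re h *\<^sub>R u1 + Im h *\<^sub>R u2)) (at z)"
    and v: "(v has_derivative (\<lambda>h. Re h *\<^sub>R v1 + Im h *\<^sub>R v2)) (at z)"
    and f: "\<And>I. I \<in> {I0, I1} \<Longrightarrow> \<forall>\<^sub>F y in nhds (slice_point I z).
        f y = u (half_plane y) + (1 / norm (oct_Im y)) *\<^sub>R (oct_Im y \<odot> v (half_plane y))"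
    and F: "\<And>I. I \<in> {I0, I1} \<Longrightarrow> dbar_F f (slice_point I z) = 0"
  shows "v1 = - u2" "Im z *\<^sub>R u1 = Im z *\<^sub>R v2 + 2 *\<^sub>R v z"
proof -
  define A B where "A = u1 - v2 - (2 / Im z) *\<^sub>R v z" and "B = v1 + u2"
  have eq: "A + I \<odot> B = 0" if "I \<in> {I0, I1}" for I
  proof -
    have IS: "I \<in> oct_sphere" using that I by auto
    have hp: "half_plane (slice_point I z) = z" using half_plane_slice_point[OF IS] z by simp
    have im: "oct_Im (slice_point I z) = Im z *\<^sub>R I" by (rule oct_Im_slice_point[OF IS])
    have n: "norm I = 1" using IS by (simp add: oct_sphere_def)
    then have "oct_Im (slice_point I z) \<noteq> 0" using z im by auto
    from dbar_F_axial[OF this, unfolded hp, OF u v f[OF that]] F[OF that] z n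
    show ?thesis by (simp add: im A_def B_def oct.scaleR_left)
  qed
  have "(I1 - I0) \<odot> B = 0"
    using eq[of I0] eq[of I1] by (simp add: oct.diff_left add_eq_0_iff)
  moreover have "oct_Re (I1 - I0) = 0" using I by (simp add: oct_sphere_def oct_Re_linear)
  ultimately have B: "B = 0" using oct_imaginary_cancel I(3) by (metis eq_iff_diff_eq_0)
  then show "v1 = - u2" by (simp add: B_def eq_neg_iff_add_eq_0)
  have "A = 0" using eq[of I0] B by (simp add: oct.zero_right)
  then have "u1 = v2 + (2 / Im z) *\<^sub>R v z" by (simp add: A_def algebra_simps)
  then show "Im z *\<^sub>R u1 = Im z *\<^sub>R v2 + 2 *\<^sub>R v z"
    using z by (simp add: scaleR_add_right)
qed

text \<open>Off the axis \<open>half_plane y\<close> and \<open>sgn (oct_Im y)\<close> depend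
  continuously on \<open>y\<close>, so the open conditions on them persist near \<open>x\<close>. A
  formula on slice points becomes an identity of functions near \<open>x\<close>, which may be
  differentiated.\<close>

lemma eventually_axial:
  fixes u v :: "complex \<Rightarrow> octonion"
  assumes D: "open D" and W: "open W"
    and f: "\<And>z I. z \<in> D \<Longrightarrow> Im z > 0 \<Longrightarrow> I \<in> oct_sphere \<inter> W \<Longrightarrow> f (slice_point I z) = u z + I \<odot> v z"
    and x: "oct_Im x \<noteq> 0" "half_plane x \<in> D" "sgn (oct_Im x) \<in> W"
  shows "\<forall>\<^sub>F y in nhds x. oct_Im y \<noteq> 0 \<and> half_plane y \<in> D \<and>
    f y = u (half_plane y) + (1 / norm (oct_Im y)) *\<^sub>R (oct_Im y \<odot> v (half_plane y))"
proof -
  have c: "isCont oct_Im x" by (rule bounded_linear.isCont[OF bounded_linear_oct_Im]) simp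
  have "isCont half_plane x" by (rule has_derivative_continuous[OF has_derivative_half_plane[OF x(1)]])
  then have "\<forall>\<^sub>F y in nhds x. half_plane y \<in> D"
    using topological_tendstoD[OF _ D x(2)] by (simp add: continuous_at eventually_nhds_conv_at x(2))
  moreover have "\<forall>\<^sub>F y in nhds x. sgn (oct_Im y) \<in> W"
    using topological_tendstoD[OF tendsto_sgn[OF c[unfolded continuous_at] x(1)] W x(3)] by (simp add: eventually_nhds_conv_at x(3))
  moreover have "\<forall>\<^sub>F y in nhds x. oct_Im y \<noteq> 0"
    using tendsto_imp_eventually_ne[OF c[unfolded continuous_at] x(1)] by (simp add: eventually_nhds_conv_at x(1))
  ultimately show ?thesis
  proof eventually_elim
    case (elim y)
    have "f (slice_point (sgn (oct_Im y)) (half_plane y)) = u (half_plane y) + sgn (oct_Im y) \<odot> v (half_plane y)"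
      using elim sgn_oct_Im_in_sphere[of y] by (intro f) auto
    then show ?case using elim unfolding slice_point_half_plane by (simp add: sgn_div_norm oct.scaleR_left divide_inverse)
  qed
qed

text \<open>The system has real coefficients and hence splits into eight scalar ones, each with its
  own \<open>\<Phi> i\<close>.\<close>

lemma axial_system_components:
  fixes u v :: "complex \<Rightarrow> octonion"
  assumes D: "open D" "convex D"
    and u: "\<And>z. z \<in> D \<Longrightarrow> (u has_derivative (\<lambda>h. Re h *\<^sub>R u1 z + Im h *\<^sub>R u2 z)) (at z)"
    and v: "\<And>z. z \<in> D \<Longrightarrow> (v has_derivative (\<lambda>h. Re h *\<^sub>R v1 z + Im h *\<^sub>R v2 z)) (at z)"
    and cont: "continuous_on D u1" "continuous_on D u2" "continuous_on D v1" "continuous_on D v2"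
    and eq1: "\<And>z. z \<in> D \<Longrightarrow> v1 z = - u2 z"
    and eq2: "\<And>z. z \<in> D \<Longrightarrow> Im z *\<^sub>R u1 z = Im z *\<^sub>R v2 z + 2 *\<^sub>R v z"
  obtains \<Phi> where "\<And>i. \<Phi> i holomorphic_on D"
    "\<And>i z. z \<in> D \<Longrightarrow> Im z * u z $ i = - Im (deriv (\<Phi> i) z)"
    "\<And>i z. z \<in> D \<Longrightarrow> (Im z)\<^sup>2 * v z $ i = Im z * Re (deriv (\<Phi> i) z) - Im (\<Phi> i z)"
proof -
  have "\<exists>\<Phi>. \<Phi> holomorphic_on D \<and> (\<forall>z\<in>D. Im z * u z $ i = - Im (deriv \<Phi> z)) \<and>
    (\<forall>z\<in>D. (Im z)\<^sup>2 * v z $ i = Im z * Re (deriv \<Phi> z) - Im (\<Phi> z))" for i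
  proof -
    have comp: "((\<lambda>z. g z $ i) has_derivative (\<lambda>h. a $ i * Re h + b $ i * Im h)) (at z)"
      if "(g has_derivative (\<lambda>h. Re h *\<^sub>R a + Im h *\<^sub>R b)) (at z)" for g :: "complex \<Rightarrow> octonion" and a b z
      using bounded_linear.has_derivative[OF bounded_linear_vec_nth that, of i] by (simp add: mult.commute)
    have cc: "continuous_on D (\<lambda>z. g z $ i)" if "continuous_on D g" for g :: "complex \<Rightarrow> octonion"
      using that by (intro continuous_intros)
    have e1: "v1 z $ i = - (u2 z $ i)" and e2: "Im z * u1 z $ i = Im z * v2 z $ i + 2 * v z $ i" if "z \<in> D" for z
      using eq1[OF that] arg_cong[OF eq2[OF that], of "\<lambda>x. x $ i"] by simp_all
    obtain \<Phi> \<Psi> where "\<Psi> holomorphic_on D"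
      and \<Phi>: "\<And>z. z \<in> D \<Longrightarrow> (\<Phi> has_field_derivative \<Psi> z) (at z)"
      "\<And>z. z \<in> D \<Longrightarrow> Im z * u z $ i = - Im (\<Psi> z)"
      "\<And>z. z \<in> D \<Longrightarrow> (Im z)\<^sup>2 * v z $ i = Im z * Re (\<Psi> z) - Im (\<Phi> z)"
      apply (rule axial_system_holomorphic[OF D comp[OF u] comp[OF v] cc[OF cont(1)] cc[OF cont(2)] cc[OF cont(3)] cc[OF cont(4)] e1 e2])
         apply assumption+
      apply (rule that)
         apply assumption+
      done
    have "deriv \<Phi> z = \<Psi> z" if "z \<in> D" for z using \<Phi>(1)[OF that] by (rule DERIV_imp_deriv)
    moreover have "\<Phi> holomorphic_on D"
      using \<Phi>(1) by (meson holomorphic_onI field_differentiable_def field_differentiable_at_within)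
    ultimately show ?thesis using \<Phi>(2,3) by auto
  qed
  then show thesis using that by metis
qed

section \<open>Octonion-valued analytic germs\<close>

definition analytic_vec :: "octonion \<Rightarrow> (octonion \<Rightarrow> octonion) \<Rightarrow> bool" where
  "analytic_vec a F \<longleftrightarrow> (\<forall>i. analytic_near a (\<lambda>x. of_real (F x $ i)))"

lemma analytic_vec_add: "analytic_vec a F \<Longrightarrow> analytic_vec a G \<Longrightarrow> analytic_vec a (\<lambda>x. F x + G x)"
  unfolding analytic_vec_def by (auto intro: analytic_near_add)

lemma analytic_vec_oct_Im: "analytic_vec a oct_Im"
  unfolding analytic_vec_def oct_Im_def oct_coord_def
  by (auto simp: intro!: analytic_near_sum analytic_near_mult analytic_near_const analytic_near_coord)

text \<open>Each coordinate of the product is a bilinear form with constant coefficients in the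
  coordinates of the factors.\<close>

lemma analytic_vec_mult:
  assumes "analytic_vec a F" "analytic_vec a G"
  shows "analytic_vec a (\<lambda>x. F x \<odot> G x)"
proof -
  have expand: "x \<odot> y = (\<Sum>j\<in>UNIV. \<Sum>k\<in>UNIV. (x $ j * y $ k) *\<^sub>R (axis j 1 \<odot> axis k 1))" for x y :: octonion
  proof -
    have e: "x = (\<Sum>j\<in>UNIV. x $ j *\<^sub>R axis j 1)" for x :: octonion
      using basis_expansion[of x] by (simp add: scalar_mult_eq_scaleR)
    have "x \<odot> y = (\<Sum>j\<in>UNIV. x $ j *\<^sub>R axis j 1) \<odot> (\<Sum>k\<in>UNIV. y $ k *\<^sub>R axis k 1)"
      using e[of x] e[of y] by simp
    also have "\<dots> = (\<Sum>j\<in>UNIV. \<Sum>k\<in>UNIV. (x $ j * y $ k) *\<^sub>R (axis j 1 \<odot> axis k 1))"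
      unfolding oct.sum_left unfolding oct.sum_right by (simp add: oct.scaleR_left oct.scaleR_right mult.commute)
    finally show ?thesis .
  qed
  have comp: "complex_of_real ((F x \<odot> G x) $ i) =
      (\<Sum>j\<in>UNIV. \<Sum>k\<in>UNIV. of_real (F x $ j) * of_real (G x $ k) * of_real ((axis j 1 \<odot> axis k 1) $ i))" for x i
    unfolding expand[of "F x" "G x"] by simp
  show ?thesis
    using assms unfolding analytic_vec_def comp
    by (intro allI analytic_near_sum analytic_near_mult analytic_near_const) blast+
qed

section \<open>Slice Fueter-regular functions\<close>

lemma oct_sphere_neq_uminus:
  assumes "J \<in> oct_sphere"
  shows "- J \<noteq> J"
proof
  assume "- J = J"
  then have "2 *\<^sub>R J = 0" unfolding scaleR_2 by (metis add.left_inverse)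
  then show False using assms by (auto simp: oct_sphere_def)
qed

text \<open>On a neighbourhood of a point of the slice half-planes the function is \<open>u + I v\<close>, where
  \<open>u\<close> and \<open>v\<close> are recovered from the values on the two slices \<open>I0\<close> and \<open>I1\<close>.\<close>

locale slice_regular_pair =
  fixes \<Omega> :: "octonion set" and f :: "octonion \<Rightarrow> octonion" and I0 I1 :: octonion and D :: "complex set"
    and f' :: "octonion \<Rightarrow> octonion \<Rightarrow>\<^sub>L octonion"
  assumes I: "I0 \<in> oct_sphere" "I1 \<in> oct_sphere" "I0 \<noteq> I1"
    and D: "open D"
    and f': "\<And>x. x \<in> \<Omega> \<Longrightarrow> (f has_derivative blinfun_apply (f' x)) (at x)" "continuous_on \<Omega> f'"
    and dbar: "\<And>x. x \<in> \<Omega> - oct_reals \<Longrightarrow> dbar_F f x = 0"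
    and sub: "\<And>z. z \<in> D \<Longrightarrow> slice_point I0 z \<in> \<Omega>" "\<And>z. z \<in> D \<Longrightarrow> slice_point I1 z \<in> \<Omega>"
begin

definition "u z = stem_u I0 I1 (f (slice_point I0 z)) (f (slice_point I1 z))"
definition "v z = stem_v I0 I1 (f (slice_point I0 z)) (f (slice_point I1 z))"
text \<open>On the slice of \<open>I\<close> the direction \<open>1\<close> of the plane becomes
  \<open>oct_e 0\<close> and \<open>\<i>\<close> becomes \<open>I\<close>; so \<open>u2\<close> and
  \<open>v2\<close> use a different direction on each of the two slices.\<close>

definition "u1 z = stem_u I0 I1 (f' (slice_point I0 z) (oct_e 0)) (f' (slice_point I1 z) (oct_e 0))"
definition "v1 z = stem_v I0 I1 (f' (slice_point I0 z) (oct_e 0)) (f' (slice_point I1 z) (oct_e 0))"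
definition "u2 z = stem_u I0 I1 (f' (slice_point I0 z) I0) (f' (slice_point I1 z) I1)"
definition "v2 z = stem_v I0 I1 (f' (slice_point I0 z) I0) (f' (slice_point I1 z) I1)"

lemma derivs:
  assumes z: "z \<in> D"
  shows "(u has_derivative (\<lambda>h. Re h *\<^sub>R u1 z + Im h *\<^sub>R u2 z)) (at z)"
    and "(v has_derivative (\<lambda>h. Re h *\<^sub>R v1 z + Im h *\<^sub>R v2 z)) (at z)"
proof -
  note d0 = slice_point_has_derivative[where f = f and f' = f' and I = I0 and z = z, OF f'(1)[OF sub(1)[OF z]]]
  note d1 = slice_point_has_derivative[where f = f and f' = f' and I = I1 and z = z, OF f'(1)[OF sub(2)[OF z]]]
  show "(u has_derivative (\<lambda>h. Re h *\<^sub>R u1 z + Im h *\<^sub>R u2 z)) (at z)"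
    using stem_pair_derivative[where L = "stem_u I0 I1", OF bounded_linear_stem_u d0 d1]
    by (simp only: u_def [abs_def] u1_def u2_def)
  show "(v has_derivative (\<lambda>h. Re h *\<^sub>R v1 z + Im h *\<^sub>R v2 z)) (at z)"
    using stem_pair_derivative[where L = "stem_v I0 I1", OF bounded_linear_stem_v d0 d1]
    by (simp only: v_def [abs_def] v1_def v2_def)
qed

lemma continuous_derivs: "continuous_on D u1" "continuous_on D u2" "continuous_on D v1" "continuous_on D v2"
proof -
  have c: "continuous_on D (\<lambda>z. blinfun_apply (f' (slice_point J z)) h)" if "\<And>z. z \<in> D \<Longrightarrow> slice_point J z \<in> \<Omega>" for J h
  proof -
    have "continuous_on D (slice_point J)"
      unfolding slice_point_def [abs_def] by (intro continuous_intros)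
    then have "continuous_on D (\<lambda>z. f' (slice_point J z))"
      by (rule continuous_on_compose2[OF f'(2)]) (use that in auto)
    then show ?thesis by (intro blinfun.continuous_on continuous_on_const)
  qed
  note c0 = c[OF sub(1)] and c1 = c[OF sub(2)]
  note u = stem_pair_continuous[where L = "stem_u I0 I1", OF bounded_linear_stem_u]
  note v = stem_pair_continuous[where L = "stem_v I0 I1", OF bounded_linear_stem_v]
  show "continuous_on D u1" unfolding u1_def [abs_def] by (rule u[OF c0 c1])
  show "continuous_on D u2" unfolding u2_def [abs_def] by (rule u[OF c0 c1])
  show "continuous_on D v1" unfolding v1_def [abs_def] by (rule v[OF c0 c1])
  show "continuous_on D v2" unfolding v2_def [abs_def] by (rule v[OF c0 c1])
qed

text \<open>A pair \<open>(a, b)\<close> that fits both \<open>I0\<close> and \<open>I1\<close> is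
  determined by the two values, so the pair shared by \<open>C\<close> must be
  \<open>(u z, v z)\<close>.\<close>

lemma stem_value:
  assumes "\<exists>a b. \<forall>J\<in>C. f (slice_point J z) = a + J \<odot> b" "I0 \<in> C" "I1 \<in> C" "J \<in> C"
  shows "f (slice_point J z) = u z + J \<odot> v z"
proof -
  obtain a b where *: "\<And>J. J \<in> C \<Longrightarrow> f (slice_point J z) = a + J \<odot> b" using assms(1) by blast
  have "v z = b" "u z = a"
    unfolding u_def v_def by (rule stem_unique[OF I]; use * assms in blast)+
  then show ?thesis using *[OF assms(4)] by simp
qed

text \<open>\<open>W\<close> is an open set of directions: the operator also differentiates
  transversally to the slices, so the representation has to hold for all units near
  \<open>I0\<close> and \<open>I1\<close>.\<close>

lemma equations:
  assumes W: "open W" "I0 \<in> W" "I1 \<in> W"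
    and f: "\<And>z J. z \<in> D \<Longrightarrow> Im z > 0 \<Longrightarrow> J \<in> oct_sphere \<inter> W \<Longrightarrow> f (slice_point J z) = u z + J \<odot> v z"
    and z: "z \<in> D" "Im z > 0"
  shows "v1 z = - u2 z" "Im z *\<^sub>R u1 z = Im z *\<^sub>R v2 z + 2 *\<^sub>R v z"
proof -
  have *: "(\<forall>\<^sub>F y in nhds (slice_point J z). f y = u (half_plane y) + (1 / norm (oct_Im y)) *\<^sub>R (oct_Im y \<odot> v (half_plane y)))
      \<and> dbar_F f (slice_point J z) = 0" if "J \<in> {I0, I1}" for J
  proof
    have J: "J \<in> oct_sphere" "J \<in> W" using that I W by auto
    have nJ: "norm J = 1" using J(1) by (simp add: oct_sphere_def)
    have im: "oct_Im (slice_point J z) = Im z *\<^sub>R J" by (rule oct_Im_slice_point[OF J(1)])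
    have nz: "oct_Im (slice_point J z) \<noteq> 0" using im nJ z by auto
    have hp: "half_plane (slice_point J z) = z" using half_plane_slice_point[OF J(1)] z by simp
    have sg: "sgn (oct_Im (slice_point J z)) = J" using im nJ z by (simp add: sgn_div_norm)
    have "\<forall>\<^sub>F y in nhds (slice_point J z). oct_Im y \<noteq> 0 \<and> half_plane y \<in> D \<and>
        f y = u (half_plane y) + (1 / norm (oct_Im y)) *\<^sub>R (oct_Im y \<odot> v (half_plane y))"
      by (rule eventually_axial[OF D W(1) f nz]) (use hp sg z J in auto)
    then show "\<forall>\<^sub>F y in nhds (slice_point J z). f y = u (half_plane y) + (1 / norm (oct_Im y)) *\<^sub>R (oct_Im y \<odot> v (half_plane y))"
      by (rule eventually_mono) blast
    have "slice_point J z \<notin> oct_reals"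
      using nz by (auto simp: oct_reals_def oct_Im_eq oct_Re_linear)
    then show "dbar_F f (slice_point J z) = 0" using that sub[OF z(1)] by (intro dbar) auto
  qed
  show "v1 z = - u2 z" "Im z *\<^sub>R u1 z = Im z *\<^sub>R v2 z + 2 *\<^sub>R v z"
    using axial_equations[OF z(2) I derivs[OF z(1)]] * by blast+
qed

end

section \<open>Analyticity at points off the real axis and on it\<close>

lemma slice_Fueter_regularE:
  assumes "slice_Fueter_regular \<Omega> f"
  obtains f' :: "octonion \<Rightarrow> octonion \<Rightarrow>\<^sub>L octonion" where "slice_function \<Omega> f"
    "\<And>x. x \<in> \<Omega> \<Longrightarrow> (f has_derivative blinfun_apply (f' x)) (at x)" "continuous_on \<Omega> f'"
    "\<And>x. x \<in> \<Omega> - oct_reals \<Longrightarrow> dbar_F f x = 0"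
  using assms unfolding slice_Fueter_regular_def continuously_differentiable_on_def by blast

text \<open>Only units of one component are known to share a stem pair. Hence \<open>f\<close> is
  studied for \<open>z\<close> in a small disc of the upper half-plane and units in a connected cap
  around the direction of \<open>x0\<close>.\<close>

lemma slice_Fueter_regular_analytic_off_axis:
  assumes \<Omega>: "open \<Omega>" and f: "slice_Fueter_regular \<Omega> f" and x0: "x0 \<in> \<Omega>" "oct_Im x0 \<noteq> 0"
  shows "\<exists>F. analytic_vec x0 F \<and> (\<forall>\<^sub>F y in nhds x0. F y = f y)"
proof -
  obtain f' where f': "slice_function \<Omega> f" "\<And>x. x \<in> \<Omega> \<Longrightarrow> (f has_derivative blinfun_apply (f' x)) (at x)"
    "continuous_on \<Omega> f'" "\<And>x. x \<in> \<Omega> - oct_reals \<Longrightarrow> dbar_F f x = 0"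
    using slice_Fueter_regularE[OF f] by metis
  obtain \<rho> where \<rho>: "\<rho> > 0" "ball x0 \<rho> \<subseteq> \<Omega>" using \<Omega> x0(1) openE by blast
  define b0 z0 I0 where "b0 = norm (oct_Im x0)" and "z0 = half_plane x0" and "I0 = sgn (oct_Im x0)"
  have b0: "b0 > 0" using x0 by (simp add: b0_def)
  have I0: "I0 \<in> oct_sphere" using sgn_oct_Im_in_sphere[OF x0(2)] by (simp add: I0_def)
  have x0_eq: "slice_point I0 z0 = x0" by (simp add: I0_def z0_def slice_point_half_plane)
  \<comment> \<open>Turning the unit by less than \<open>2 * \<delta>\<close> moves a point at
    height \<open>b0\<close> by at most \<open>\<rho> / 2\<close>; the other half of the radius is
    left for \<open>z\<close>. The bound 1 keeps the origin out of
    \<open>ball I0 \<delta>\<close>.\<close>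
  define \<delta> where "\<delta> = min 1 (\<rho> / (4 * b0))"
  have \<delta>: "\<delta> > 0" "\<delta> \<le> 1" "2 * \<delta> * b0 \<le> \<rho> / 2"
    using \<rho> b0 by (auto simp: \<delta>_def min_def field_simps)
  \<comment> \<open>A radius of at most \<open>b0\<close> keeps the disc in the open upper
    half-plane.\<close>
  define D where "D = ball z0 (min b0 (\<rho> / 2))"
  have D: "open D" "convex D" "z0 \<in> D" using \<rho> b0 by (auto simp: D_def)
  have ImD: "Im z > 0" if "z \<in> D" for z
  proof -
    have "\<bar>Im (z0 - z)\<bar> < b0" using that abs_Im_le_cmod[of "z0 - z"] by (simp add: D_def dist_norm)
    then show ?thesis by (simp add: z0_def b0_def)
  qed
  \<comment> \<open>The cap \<open>C\<close> is the radial projection of a convex piece of the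
    imaginary hyperplane, which makes it connected.\<close>
  define K where "K = {y. oct_Re y = 0} \<inter> ball I0 \<delta>"
  define C where "C = sgn ` K"
  have n0: "norm I0 = 1" using I0 by (simp add: oct_sphere_def)
  have K0: "y \<noteq> 0" if "y \<in> K" for y using that \<delta>(2) n0 by (auto simp: K_def)
  have "convex {y. oct_Re y = 0}"
    using convex_hyperplane[of "oct_e 0" 0] by (simp add: oct_Re_def oct_coord_eq_inner inner_commute)
  then have "convex K" unfolding K_def by (intro convex_Int convex_ball)
  then have C: "connected C"
    unfolding C_def by (intro connected_continuous_image convex_connected) (auto intro!: continuous_intros dest: K0)
  have CS: "C \<subseteq> oct_sphere"
    using K0 by (auto simp: C_def K_def oct_sphere_def norm_sgn sgn_div_norm oct_Re_linear)
  have capC: "oct_sphere \<inter> ball I0 \<delta> \<subseteq> C"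
  proof
    fix J assume J: "J \<in> oct_sphere \<inter> ball I0 \<delta>"
    then have "J = sgn J" "J \<in> K" by (auto simp: oct_sphere_def K_def sgn_div_norm)
    then show "J \<in> C" unfolding C_def by blast
  qed
  have sub: "slice_point J z \<in> \<Omega>" if J: "J \<in> C" and z: "z \<in> D" for J z
  proof -
    obtain y where y: "y \<in> K" "J = sgn y" using J unfolding C_def by blast
    have JS: "J \<in> oct_sphere" using CS J by blast
    have ny: "norm y > 0" using K0[OF y(1)] by simp
    have "sgn y - y = ((1 - norm y) / norm y) *\<^sub>R y"
    proof -
      have "(1 - norm y) / norm y = inverse (norm y) - 1" using ny by (simp add: field_simps)
      then show ?thesis by (simp only: sgn_div_norm scaleR_diff_left scaleR_one)
    qed
    \<comment> \<open>Projection to the sphere moves \<open>y\<close> by less than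
      \<open>\<delta>\<close>, hence the factor 2 in the bound on \<open>J - I0\<close>.\<close>
    then have "norm (sgn y - y) = \<bar>norm I0 - norm y\<bar>" using ny n0 by simp
    also have "\<dots> \<le> norm (I0 - y)" by (rule norm_triangle_ineq3)
    also have "\<dots> < \<delta>" using y(1) by (simp add: K_def dist_norm)
    finally have "norm (sgn y - y) < \<delta>" .
    moreover have "norm (y - I0) < \<delta>" using y(1) by (simp add: K_def dist_norm norm_minus_commute)
    ultimately have JI: "norm (J - I0) < 2 * \<delta>"
      using norm_triangle_ineq[of "sgn y - y" "y - I0"] y(2) by simp
    have "slice_point J z - x0 = slice_point J (z - z0) + b0 *\<^sub>R (J - I0)"
      unfolding x0_eq[symmetric] by (simp add: slice_point_def z0_def b0_def algebra_simps)
    then have "norm (slice_point J z - x0) \<le> norm (z - z0) + b0 * norm (J - I0)"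
      using norm_triangle_ineq[of "slice_point J (z - z0)" "b0 *\<^sub>R (J - I0)"] b0
      by (simp add: norm_slice_point[OF JS])
    moreover have "norm (z - z0) < \<rho> / 2" using z by (simp add: D_def dist_norm norm_minus_commute)
    moreover have "b0 * norm (J - I0) \<le> b0 * (2 * \<delta>)" using JI b0 by (intro mult_left_mono) auto
    then have "b0 * norm (J - I0) \<le> \<rho> / 2" using \<delta>(3) by (simp add: mult_ac)
    ultimately have "norm (slice_point J z - x0) < \<rho>" by linarith
    then show ?thesis using \<rho>(2) by (auto simp: dist_norm norm_minus_commute)
  qed
  \<comment> \<open>A connected set with more than one point has no isolated points, so a second
    unit exists arbitrarily close to \<open>I0\<close>.\<close>
  have "oct_sphere \<noteq> {J}" for J
    using oct_sphere_uminus oct_sphere_neq_uminus by blast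
  then have "I0 islimpt oct_sphere" by (intro connected_imp_perfect connected_oct_sphere I0)
  then obtain I1 where I1: "I1 \<in> oct_sphere" "I1 \<noteq> I0" "dist I1 I0 < \<delta>"
    using \<delta>(1) unfolding islimpt_approachable by blast
  have IC: "I0 \<in> C" "I1 \<in> C" using capC I0 I1 \<delta>(1) by (auto simp: dist_commute)
  interpret P: slice_regular_pair \<Omega> f I0 I1 D f'
    by unfold_locales (use I0 I1 D f' sub IC in auto)
  have val: "f (slice_point J z) = P.u z + J \<odot> P.v z" if "z \<in> D" "J \<in> C" for z J
    by (rule P.stem_value[OF slice_function_connected[OF f'(1) ImD[OF that(1)] C CS] IC that(2)]) (rule sub[OF _ that(1)])
  have val': "f (slice_point J z) = P.u z + J \<odot> P.v z" if "z \<in> D" "Im z > 0" "J \<in> oct_sphere \<inter> ball I0 \<delta>" for z J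
    using val that capC by blast
  have W: "open (ball I0 \<delta>)" "I0 \<in> ball I0 \<delta>" "I1 \<in> ball I0 \<delta>" using \<delta>(1) I1 by (auto simp: dist_commute)
  have eqs: "P.v1 z = - P.u2 z" "Im z *\<^sub>R P.u1 z = Im z *\<^sub>R P.v2 z + 2 *\<^sub>R P.v z" if "z \<in> D" for z
    by (rule P.equations[OF W _ that ImD[OF that]]; use val' in blast)+
  obtain \<Phi> where \<Phi>: "\<And>i. \<Phi> i holomorphic_on D"
    "\<And>i z. z \<in> D \<Longrightarrow> Im z * P.u z $ i = - Im (deriv (\<Phi> i) z)"
    "\<And>i z. z \<in> D \<Longrightarrow> (Im z)\<^sup>2 * P.v z $ i = Im z * Re (deriv (\<Phi> i) z) - Im (\<Phi> i z)"
    using axial_system_components[OF D(1,2) P.derivs P.continuous_derivs eqs]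
    by (metis (no_types, lifting))
  \<comment> \<open>\<open>U\<close> is \<open>u\<close> solved from
    \<open>b u = - Im \<Phi>'\<close>, and \<open>V\<close> is \<open>v / b\<close>; the additional
    division by \<open>b\<close> compensates for multiplying by \<open>Im y = b I\<close>.\<close>
  define U :: "octonion \<Rightarrow> octonion" where "U = (\<lambda>y. \<chi> i. - Im (deriv (\<Phi> i) (half_plane y)) * (1 / norm (oct_Im y)))"
  define V :: "octonion \<Rightarrow> octonion" where "V = (\<lambda>y. \<chi> i. (norm (oct_Im y) * Re (deriv (\<Phi> i) (half_plane y)) - Im (\<Phi> i (half_plane y)))
      * ((1 / norm (oct_Im y)) * (1 / norm (oct_Im y)) * (1 / norm (oct_Im y))))"
  have z0D: "half_plane x0 \<in> D" using D(3) by (simp add: z0_def)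
  have an: "analytic_near x0 (\<lambda>y. \<Phi> i (half_plane y))" "analytic_near x0 (\<lambda>y. deriv (\<Phi> i) (half_plane y))" for i
    using analytic_near_compose[OF analytic_near_half_plane[OF x0(2)] \<Phi>(1) D(1) z0D]
      analytic_near_compose[OF analytic_near_half_plane[OF x0(2)] holomorphic_deriv[OF \<Phi>(1) D(1)] D(1) z0D] by blast+
  have "analytic_vec x0 U"
    unfolding analytic_vec_def U_def vec_lambda_beta of_real_mult of_real_minus
    by (intro allI analytic_near_mult analytic_near_uminus analytic_near_Im an analytic_near_inverse_norm_Im x0)
  moreover have "analytic_vec x0 V"
    unfolding analytic_vec_def V_def vec_lambda_beta of_real_mult of_real_diff
    by (intro allI analytic_near_mult analytic_near_diff analytic_near_Im analytic_near_Re an analytic_near_norm_Im analytic_near_inverse_norm_Im x0)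
  ultimately have "analytic_vec x0 (\<lambda>y. U y + oct_Im y \<odot> V y)"
    by (intro analytic_vec_add analytic_vec_mult analytic_vec_oct_Im)
  moreover have "\<forall>\<^sub>F y in nhds x0. U y + oct_Im y \<odot> V y = f y"
  proof (rule eventually_mono[OF eventually_axial[OF D(1) W(1) val' x0(2) z0D]])
    show "sgn (oct_Im x0) \<in> ball I0 \<delta>" using W(2) by (simp add: I0_def)
    fix y assume *: "oct_Im y \<noteq> 0 \<and> half_plane y \<in> D \<and>
      f y = P.u (half_plane y) + (1 / norm (oct_Im y)) *\<^sub>R (oct_Im y \<odot> P.v (half_plane y))"
    then have y: "oct_Im y \<noteq> 0" "half_plane y \<in> D" by blast+
    have "U y = P.u (half_plane y)"
      using \<Phi>(2)[OF y(2)] y(1) by (simp add: vec_eq_iff U_def field_simps)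
    moreover have "V y = (1 / norm (oct_Im y)) *\<^sub>R P.v (half_plane y)"
      unfolding vec_eq_iff V_def vec_lambda_beta half_plane_simps(2)[symmetric] \<Phi>(3)[OF y(2), symmetric]
      using y(1) by (simp add: power2_eq_square)
    ultimately show "U y + oct_Im y \<odot> V y = f y"
      using * by (simp add: oct.scaleR_right)
  qed
  ultimately show ?thesis by blast
qed

text \<open>Points of the real axis are limits of points off the axis.\<close>

lemma continuous_eq_across_axis:
  fixes g h :: "octonion \<Rightarrow> complex"
  assumes g: "continuous_on (ball a \<rho>) g" and h: "continuous_on (ball a \<rho>) h"
    and eq: "\<And>y. y \<in> ball a \<rho> \<Longrightarrow> oct_Im y \<noteq> 0 \<Longrightarrow> g y = h y"
    and y: "y \<in> ball a \<rho>"
  shows "g y = h y"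
proof (cases "oct_Im y = 0")
  case True
  let ?p = "\<lambda>t::real. y + t *\<^sub>R oct_e 1"
  have p: "(?p \<longlongrightarrow> y) (at_right 0)"
    by (auto intro!: tendsto_eq_intros)
  have ev: "\<forall>\<^sub>F t in at_right 0. ?p t \<in> ball a \<rho>"
    by (rule topological_tendstoD[OF p open_ball y])
  have lim: "((\<lambda>t. k (?p t)) \<longlongrightarrow> k y) (at_right 0)" if "continuous_on (ball a \<rho>) k" for k :: "octonion \<Rightarrow> complex"
    using that y p by (metis continuous_on_eq_continuous_at open_ball isCont_tendsto_compose)
  have "\<forall>\<^sub>F t in at_right 0. g (?p t) = h (?p t)"
    using ev eventually_at_right_less[of 0]
  proof eventually_elim
    case (elim t)
    have "oct_Im (?p t) = oct_Im y + t *\<^sub>R oct_Im (oct_e 1)"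
      using bounded_linear_oct_Im by (simp add: linear_add linear_scale bounded_linear.linear)
    also have "\<dots> = t *\<^sub>R oct_e 1" using True oct_sphere_Im[OF oct_e_in_sphere[of 1]] by simp
    finally have "oct_Im (?p t) \<noteq> 0" using elim norm_oct_e[of 1] by auto
    then show ?case using eq elim by blast
  qed
  then have "((\<lambda>t. h (?p t)) \<longlongrightarrow> g y) (at_right 0)"
    using lim[OF g] by (simp add: tendsto_cong)
  then show ?thesis using lim[OF h] tendsto_unique by (metis trivial_limit_at_right_real)
qed (use eq y in blast)

text \<open>A ball around a real point contains, with \<open>a + b I\<close>, the points
  \<open>a + b J\<close> for all units \<open>J\<close>, so the whole connected sphere shares one
  stem pair.\<close>

lemma slice_Fueter_regular_analytic_on_axis:
  assumes \<Omega>: "open \<Omega>" and f: "slice_Fueter_regular \<Omega> f" and x0: "r *\<^sub>R oct_e 0 \<in> \<Omega>"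
  shows "\<exists>F. analytic_vec (r *\<^sub>R oct_e 0) F \<and> (\<forall>\<^sub>F y in nhds (r *\<^sub>R oct_e 0). F y = f y)"
proof -
  obtain f' where f': "slice_function \<Omega> f" "\<And>x. x \<in> \<Omega> \<Longrightarrow> (f has_derivative blinfun_apply (f' x)) (at x)"
    "continuous_on \<Omega> f'" "\<And>x. x \<in> \<Omega> - oct_reals \<Longrightarrow> dbar_F f x = 0"
    using slice_Fueter_regularE[OF f] by metis
  obtain R where R: "R > 0" "ball (r *\<^sub>R oct_e 0) R \<subseteq> \<Omega>" using \<Omega> x0 openE by blast
  define D where "D = ball (complex_of_real r) R"
  have D: "open D" "convex D" by (auto simp: D_def)
  have cnjD: "cnj z \<in> D \<longleftrightarrow> z \<in> D" for z
    unfolding D_def mem_ball dist_norm by (metis complex_cnj_complex_of_real complex_cnj_diff complex_mod_cnj)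
  have in_ball: "slice_point J z \<in> ball (r *\<^sub>R oct_e 0) R \<longleftrightarrow> z \<in> D" if "J \<in> oct_sphere" for J z
  proof -
    have "slice_point J (of_real r) = r *\<^sub>R oct_e 0" by (simp add: slice_point_def)
    then show ?thesis
      using norm_slice_point[OF that, of "of_real r - z"] slice_point_diff[of J "of_real r" z]
      by (simp add: D_def dist_norm)
  qed
  then have sub: "slice_point J z \<in> \<Omega>" if "J \<in> oct_sphere" "z \<in> D" for J z using that R by blast
  \<comment> \<open>Any unit would do: the slices of \<open>- J\<close> and \<open>J\<close> run
    through the same plane in opposite orientations, so conjugating \<open>z\<close> exchanges
    them.\<close>
  define J where "J = oct_e 1"
  have J: "J \<in> oct_sphere" "- J \<in> oct_sphere" "- J \<noteq> J"
    using oct_e_in_sphere[of 1] by (simp_all add: J_def oct_sphere_uminus oct_sphere_neq_uminus)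
  interpret P: slice_regular_pair \<Omega> f "- J" J D f'
    by unfold_locales (use J D f' sub in auto)
  have val: "f (slice_point I z) = P.u z + I \<odot> P.v z" if "z \<in> D" "Im z > 0" "I \<in> oct_sphere \<inter> UNIV" for z I
    by (rule P.stem_value[OF slice_function_connected[OF f'(1) that(2) connected_oct_sphere order_refl] J(2,1)])
       (use that sub in auto)
  have upper: "P.v1 z = - P.u2 z" "Im z *\<^sub>R P.u1 z = Im z *\<^sub>R P.v2 z + 2 *\<^sub>R P.v z" if "z \<in> D" "Im z > 0" for z
    by (rule P.equations[OF open_UNIV UNIV_I UNIV_I _ that]; use val in blast)+
  have cnj: "P.u (cnj z) = P.u z" "P.v (cnj z) = - P.v z" "P.u1 (cnj z) = P.u1 z" "P.v1 (cnj z) = - P.v1 z"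
    "P.u2 (cnj z) = - P.u2 z" "P.v2 (cnj z) = P.v2 z" for z
  proof -
    have s: "slice_point J (cnj z) = slice_point (- J) z" "slice_point (- J) (cnj z) = slice_point J z"
      by (simp_all add: slice_point_uminus)
    show "P.u (cnj z) = P.u z" "P.v (cnj z) = - P.v z" "P.u1 (cnj z) = P.u1 z" "P.v1 (cnj z) = - P.v1 z"
      unfolding P.u_def P.v_def P.u1_def P.v1_def s by (rule stem_swap stem_u_swap[OF J(1)])+
    \<comment> \<open>Reversing the slice also negates the direction of differentiation, which flips
      the parity: \<open>u2\<close> is odd and \<open>v2\<close> is even.\<close>
    have m: "f' x (- J) = - f' x J" "f' x J = - f' x (- J)" for x by (simp_all add: blinfun.minus_right)
    show "P.u2 (cnj z) = - P.u2 z"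
      unfolding P.u2_def s using stem_u_swap[OF J(1)] by (metis m)
    show "P.v2 (cnj z) = P.v2 z"
      unfolding P.v2_def s using stem_swap by (metis m minus_minus)
  qed
  \<comment> \<open>The lower half follows from the upper by parity. On the axis the odd functions
    \<open>P.v1\<close>, \<open>P.u2\<close>, \<open>P.v\<close> vanish and the other terms carry
    the factor \<open>Im z\<close>, so the system holds there without passing to a limit.\<close>
  have eq1: "P.v1 z = - P.u2 z" and eq2: "Im z *\<^sub>R P.u1 z = Im z *\<^sub>R P.v2 z + 2 *\<^sub>R P.v z" if z: "z \<in> D" for z
  proof -
    consider "Im z > 0" | "Im z < 0" | "z = cnj z" by (force simp: complex_eq_iff)
    then have "P.v1 z = - P.u2 z \<and> Im z *\<^sub>R P.u1 z = Im z *\<^sub>R P.v2 z + 2 *\<^sub>R P.v z"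
    proof cases
      case 1
      then show ?thesis using upper[OF z] by blast
    next
      case 2
      then have "- P.v1 z = P.u2 z" "- (Im z *\<^sub>R P.u1 z) = - (Im z *\<^sub>R P.v2 z + 2 *\<^sub>R P.v z)"
        using upper[of "cnj z"] z by (simp_all add: cnjD cnj)
      then show ?thesis using neg_equal_iff_equal by (metis minus_minus)
    next
      case 3
      have self: "w = 0" if "w = - w" for w :: octonion
        using that by (simp add: vec_eq_iff)
      have "P.v1 z = - P.v1 z" "P.u2 z = - P.u2 z" "P.v z = - P.v z"
        using cnj(2,4,5)[of z] unfolding 3[symmetric] by simp_all
      then have "P.v1 z = 0" "P.u2 z = 0" "P.v z = 0" by (blast intro: self)+
      moreover have "Im z = 0" using 3 by (simp add: complex_eq_iff)
      ultimately show ?thesis by simp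
    qed
    then show "P.v1 z = - P.u2 z" "Im z *\<^sub>R P.u1 z = Im z *\<^sub>R P.v2 z + 2 *\<^sub>R P.v z" by auto
  qed
  obtain \<Phi> where \<Phi>: "\<And>i. \<Phi> i holomorphic_on D"
    "\<And>i z. z \<in> D \<Longrightarrow> Im z * P.u z $ i = - Im (deriv (\<Phi> i) z)"
    "\<And>i z. z \<in> D \<Longrightarrow> (Im z)\<^sup>2 * P.v z $ i = Im z * Re (deriv (\<Phi> i) z) - Im (\<Phi> i z)"
    using axial_system_components[OF D P.derivs P.continuous_derivs eq1 eq2]
    by (metis (no_types, lifting))
  have "\<exists>U V \<rho>. \<rho> > 0 \<and> analytic_near (r *\<^sub>R oct_e 0) (\<lambda>y. of_real (U y)) \<and> analytic_near (r *\<^sub>R oct_e 0) (\<lambda>y. of_real (V y)) \<and>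
     (\<forall>y\<in>ball (r *\<^sub>R oct_e 0) \<rho>. oct_Im y \<noteq> 0 \<longrightarrow>
        2 * norm (oct_Im y) * U y = Im (deriv (\<Phi> i) (half_plane y)) - Im (deriv (\<Phi> i) (cnj (half_plane y))) \<and>
        2 * norm (oct_Im y) ^ 3 * V y =
        norm (oct_Im y) * (Re (deriv (\<Phi> i) (half_plane y)) + Re (deriv (\<Phi> i) (cnj (half_plane y))))
        - (Im (\<Phi> i (half_plane y)) - Im (\<Phi> i (cnj (half_plane y)))))" for i
    using symmetrized_series_analytic[OF \<Phi>(1)[of i, unfolded D_def] R(1)] by metis
  then obtain U V \<rho> where \<rho>: "\<And>i. \<rho> i > 0"
    and an: "\<And>i. analytic_near (r *\<^sub>R oct_e 0) (\<lambda>y. of_real (U i y))" "\<And>i. analytic_near (r *\<^sub>R oct_e 0) (\<lambda>y. of_real (V i y))"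
    and UV: "\<And>i y. y \<in> ball (r *\<^sub>R oct_e 0) (\<rho> i) \<Longrightarrow> oct_Im y \<noteq> 0 \<Longrightarrow>
        2 * norm (oct_Im y) * U i y = Im (deriv (\<Phi> i) (half_plane y)) - Im (deriv (\<Phi> i) (cnj (half_plane y)))"
      "\<And>i y. y \<in> ball (r *\<^sub>R oct_e 0) (\<rho> i) \<Longrightarrow> oct_Im y \<noteq> 0 \<Longrightarrow>
        2 * norm (oct_Im y) ^ 3 * V i y =
        norm (oct_Im y) * (Re (deriv (\<Phi> i) (half_plane y)) + Re (deriv (\<Phi> i) (cnj (half_plane y))))
        - (Im (\<Phi> i (half_plane y)) - Im (\<Phi> i (cnj (half_plane y))))"
    by metis
  \<comment> \<open>The minus sign comes from \<open>b u = - Im \<Phi>'\<close>; \<open>V\<close>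
    stands for \<open>v / b\<close>, so its product with \<open>Im y = b I\<close> is
    \<open>I v\<close>.\<close>
  define F :: "octonion \<Rightarrow> octonion" where "F = (\<lambda>y. (\<chi> i. - U i y) + oct_Im y \<odot> (\<chi> i. V i y))"
  have anF: "analytic_vec (r *\<^sub>R oct_e 0) F"
    unfolding F_def
    by (intro analytic_vec_add analytic_vec_mult analytic_vec_oct_Im)
       (auto simp: analytic_vec_def intro!: analytic_near_uminus an)
  have off: "F y = f y" if y: "y \<in> ball (r *\<^sub>R oct_e 0) (min R (Min (range \<rho>)))" and nz: "oct_Im y \<noteq> 0" for y
  proof -
    define b z where "b = norm (oct_Im y)" and "z = half_plane y"
    have b: "b > 0" using nz by (simp add: b_def)
    have Iz: "Im z = b" by (simp add: z_def b_def)
    have yz: "slice_point (sgn (oct_Im y)) z = y" by (simp add: z_def slice_point_half_plane)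
    have S: "sgn (oct_Im y) \<in> oct_sphere" using sgn_oct_Im_in_sphere[OF nz] .
    have zD: "z \<in> D" using in_ball[OF S, of z] yz y by simp
    then have zD': "cnj z \<in> D" by (simp add: cnjD)
    have yi: "y \<in> ball (r *\<^sub>R oct_e 0) (\<rho> i)" for i using y by auto
    \<comment> \<open>By parity the two conjugate points contribute equally, which accounts for the
      factor 2.\<close>
    have "- U i y = P.u z $ i" for i
    proof -
      have "2 * b * U i y = - (2 * b * P.u z $ i)"
        using UV(1)[OF yi nz, of i] \<Phi>(2)[OF zD, of i] \<Phi>(2)[OF zD', of i]
        by (simp add: b_def[symmetric] z_def[symmetric] cnj Iz)
      then have "2 * b * (- U i y) = 2 * b * P.u z $ i" by simp
      then show ?thesis using b by (simp only: mult_cancel_left) simp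
    qed
    moreover have "V i y = (1 / b) * P.v z $ i" for i
    proof -
      have "2 * b ^ 3 * V i y = 2 * (b\<^sup>2 * P.v z $ i)"
        using UV(2)[OF yi nz, of i] \<Phi>(3)[OF zD, of i] \<Phi>(3)[OF zD', of i]
        by (simp add: b_def[symmetric] z_def[symmetric] cnj Iz algebra_simps)
      then show ?thesis using b by (simp add: power2_eq_square power3_eq_cube field_simps)
    qed
    ultimately have "F y = P.u z + oct_Im y \<odot> ((1 / b) *\<^sub>R P.v z)"
      unfolding F_def by (intro arg_cong2[of _ _ _ _ "(+)"] arg_cong2[of _ _ _ _ "(\<odot>)"] refl) (simp_all add: vec_eq_iff)
    also have "\<dots> = P.u z + sgn (oct_Im y) \<odot> P.v z"
      by (simp add: oct.scaleR_left oct.scaleR_right sgn_div_norm b_def divide_inverse)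
    also have "\<dots> = f y" using val[OF zD, of "sgn (oct_Im y)"] b Iz S yz by simp
    finally show ?thesis .
  qed
  \<comment> \<open>So far \<open>F\<close> and \<open>f\<close> agree off the axis only; continuity
    of both extends this to the axis, one coordinate at a time.\<close>
  have "\<forall>\<^sub>F y in nhds (r *\<^sub>R oct_e 0). F y $ i = f y $ i" for i
  proof -
    obtain \<sigma> where \<sigma>: "\<sigma> > 0" "continuous_on (ball (r *\<^sub>R oct_e 0) \<sigma>) (\<lambda>y. complex_of_real (F y $ i))"
      using analytic_near_continuous anF unfolding analytic_vec_def by metis
    define \<tau> where "\<tau> = min \<sigma> (min R (Min (range \<rho>)))"
    have \<tau>: "\<tau> > 0" using \<sigma>(1) R(1) \<rho> by (auto simp: \<tau>_def)
    have sub1: "ball (r *\<^sub>R oct_e 0) \<tau> \<subseteq> ball (r *\<^sub>R oct_e 0) \<sigma>"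
      and sub2: "ball (r *\<^sub>R oct_e 0) \<tau> \<subseteq> ball (r *\<^sub>R oct_e 0) (min R (Min (range \<rho>)))"
      and sub3: "ball (r *\<^sub>R oct_e 0) \<tau> \<subseteq> \<Omega>"
      using R(2) by (auto simp: \<tau>_def)
    have "continuous_on (ball (r *\<^sub>R oct_e 0) \<tau>) f"
      using f'(2) sub3 by (meson continuous_at_imp_continuous_on has_derivative_continuous subsetD)
    then have cf: "continuous_on (ball (r *\<^sub>R oct_e 0) \<tau>) (\<lambda>y. complex_of_real (f y $ i))"
      by (intro continuous_intros)
    have "complex_of_real (F y $ i) = complex_of_real (f y $ i)" if "y \<in> ball (r *\<^sub>R oct_e 0) \<tau>" for y
      by (rule continuous_eq_across_axis[OF continuous_on_subset[OF \<sigma>(2) sub1] cf _ that]) (use off sub2 in auto)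
    then show ?thesis
      using \<tau> unfolding eventually_nhds_metric by (metis dist_commute mem_ball of_real_eq_iff)
  qed
  then have "\<forall>\<^sub>F y in nhds (r *\<^sub>R oct_e 0). \<forall>i. F y $ i = f y $ i"
    by (simp add: eventually_all_finite)
  then show ?thesis using anF by (auto simp: vec_eq_iff)
qed

theorem corollary3p11:
  fixes \<Omega> :: "octonion set" and f :: "octonion \<Rightarrow> octonion"
  assumes "open \<Omega>" and "connected \<Omega>" and "\<Omega> \<noteq> {}"
    and "slice_Fueter_regular \<Omega> f"
  shows "f real_analytic_on \<Omega>"
proof (rule real_analytic_onI[OF assms(1)])
  fix a i assume a: "a \<in> \<Omega>"
  have "\<exists>F. analytic_vec a F \<and> (\<forall>\<^sub>F y in nhds a. F y = f y)"
  proof (cases "oct_Im a = 0")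
    case True
    then have "oct_Re a *\<^sub>R oct_e 0 = a" using oct_Re_Im[of a] by simp
    then show ?thesis
      using slice_Fueter_regular_analytic_on_axis[OF assms(1,4), of "oct_Re a"] a by simp
  qed (use slice_Fueter_regular_analytic_off_axis[OF assms(1,4) a] in blast)
  then obtain F where "analytic_vec a F" "\<forall>\<^sub>F y in nhds a. F y = f y" by blast
  then show "\<exists>g. analytic_near a g \<and> (\<forall>\<^sub>F x in nhds a. g x = of_real (f x $ i))"
    unfolding analytic_vec_def
    by (intro exI[of _ "\<lambda>x. of_real (F x $ i)"]) (auto elim: eventually_mono)
qed

end
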